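(* Let $n\ge1$ be an integer and let $$G_n=\langle \sigma,\tau,\rho:\ \rho^4=\sigma^8=\tau^{2^{n+2}}=1,\ \sigma^4=\tau^{2^{n+1}},\ \rho^2=\tau^{2^n}\sigma^2,\ [\tau,\sigma]=1,\ [\rho,\sigma]=\sigma^{-2},\ [\rho,\tau]=\tau^2\rangle .$$ Let $H_{i,2}$ and $H_{i,4}$ ($1\le i\le7$) be the subgroups of $G_n$ of index $2$ and $4$ listed in the context, and for each such subgroup $H$ let $\mathrm{V}_{G_n\to H}:G_n/G_n'\to H/H'$ be the transfer map. Then: 1. $\ker \mathrm{V}_{G_n\to H_{1,2}}=\langle\tau G_n'\rangle$. 2. $\ker \mathrm{V}_{G_n\to H_{2,2}}=\langle\sigma G_n',\rho G_n'\rangle$ if $n=1$, and $=\langle\sigma G_n',\tau\rho G_n'\rangle$ if $n\ge2$. 3. $\ker \mathrm{V}_{G_n\to H_{3,2}}=\langle\tau G_n',\rho G_n'\rangle$. 4. $\ker \mathrm{V}_{G_n\to H_{4,2}}=\langle\tau\rho G_n',\sigma\rho G_n'\rangle$ if $n=1$, and $=\langle\sigma\tau G_n',\rho G_n'\rangle$ if $n\ge2$. 5. $\ker \mathrm{V}_{G_n\to H_{5,2}}=\langle\tau G_n',\sigma\rho G_n'\rangle$. 6. $\ker \mathrm{V}_{G_n\to H_{6,2}}=\langle\sigma G_n',\tau\rho G_n'\rangle$ if $n=1$, and $=\langle\rho G_n',\sigma G_n'\rangle$ if $n\ge2$. 7. $\ker \mathrm{V}_{G_n\to H_{7,2}}=\langle\sigma\tau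 G_n',\rho G_n'\rangle$ if $n=1$, and $=\langle\sigma\tau G_n',\tau\rho G_n'\rangle$ if $n\ge2$. 8. For all $1\le i\le7$, $\ker \mathrm{V}_{G_n\to H_{i,4}}=G_n/G_n'$.
   Context: Commutators are $[x,y]=x^{-1}y^{-1}xy$, and $H'=[H,H]$ is the derived subgroup of $H$. For a normal subgroup $H$ of finite index of a group $G$, the transfer map $\mathrm{V}_{G\to H}:G/G'\to H/H'$ is given by $\mathrm{V}_{G\to H}(gG')=\prod_{i=1}^t x_i^{-1}g^f x_i\,H'$, where $f=[\langle g\rangle H:H]$ and $x_1,\dots,x_t$ is a set of representatives of $G/\langle g\rangle H$. Subgroups of index $2$: $H_{1,2}=\langle\sigma,\tau\rangle$; $H_{2,2}=\langle\sigma,\rho\rangle$ if $n=1$ and $\langle\sigma,\tau^2,\rho\rangle$ if $n\ge2$; $H_{3,2}=\langle\rho,\tau\rangle$; $H_{4,2}=\langle\sigma\tau,\rho,\sigma^2\rangle$ if $n=1$ and $\langle\sigma\tau,\rho\rangle$ if $n\ge2$; $H_{5,2}=\langle\sigma\rho,\tau\rangle$; $H_{6,2}=\langle\tau\rho,\sigma\rangle$ if $n=1$ and $\langle\tau\rho,\sigma,\tau^2\rangle$ if $n\ge2$; $H_{7,2}=\langle\sigma\tau,\tau\rho,\sigma^2\rangle$ if $n=1$ and $\langle\sigma\tau,\tau\rho\rangle$ if $n\ge2$. Subgroups of index $4$: $H_{1,4}=\langle\sigma,\tau^2\rangle$; $H_{2,4}=\langle\tau,\sigma^2\rangle$; $H_{3,4}=\langle\rho,\tau^2\rangle$;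 $H_{4,4}=\langle\sigma\tau,\sigma^2\rangle$; $H_{5,4}=\langle\sigma\rho,\tau^2\rangle$; $H_{6,4}=\langle\tau\rho,\tau^2\rangle$; $H_{7,4}=\langle\sigma\tau\rho,\tau^2\rangle$. All these subgroups are normal in $G_n$. *)

theory Defs
  imports "HOL-Algebra.Generated_Groups" "HOL-Algebra.FiniteProduct"
begin

section \<open>Groups given by generators and relations\<close>

text \<open>A letter \<open>(x, True)\<close> stands for the generator \<open>x\<close> and \<open>(x, False)\<close> for its inverse. A relation
  is a pair \<open>(l, r)\<close> of words, read as the equation \<open>l = r\<close>.\<close>

type_synonym 'a gword = "('a \<times> bool) list"

inductive pres_eq :: "('a gword \<times> 'a gword) set \<Rightarrow> 'a gword \<Rightarrow> 'a gword \<Rightarrow> bool"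
  for R where
  refl: "pres_eq R u u"
| sym: "pres_eq R u v \<Longrightarrow> pres_eq R v u"
| trans: "pres_eq R u v \<Longrightarrow> pres_eq R v w \<Longrightarrow> pres_eq R u w"
| cancel: "pres_eq R (u @ [(x, b), (x, \<not> b)] @ v) (u @ v)"
| rel: "(l, r) \<in> R \<Longrightarrow> pres_eq R (u @ l @ v) (u @ r @ v)"

definition pres_class :: "('a gword \<times> 'a gword) set \<Rightarrow> 'a gword \<Rightarrow> 'a gword set" where
  "pres_class R w = {v. pres_eq R w v}"

definition presented_group :: "('a gword \<times> 'a gword) set \<Rightarrow> 'a gword set monoid" where
  "presented_group R =
     \<lparr>carrier = range (pres_class R),
      monoid.mult = (\<lambda>A B. \<Union>a\<in>A. \<Union>b\<in>B. pres_class R (a @ b)),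
      one = pres_class R []\<rparr>"

definition gword_inv :: "'a gword \<Rightarrow> 'a gword" where
  "gword_inv w = rev (map (\<lambda>(x, b). (x, \<not> b)) w)"

definition gword_pow :: "'a gword \<Rightarrow> nat \<Rightarrow> 'a gword" where
  "gword_pow w k = concat (replicate k w)"

definition gword_comm :: "'a gword \<Rightarrow> 'a gword \<Rightarrow> 'a gword" where
  "gword_comm x y = gword_inv x @ gword_inv y @ x @ y"

lemma pres_class_eq_iff: "pres_class R u = pres_class R v \<longleftrightarrow> pres_eq R u v"
proof
  assume "pres_class R u = pres_class R v"
  then have "v \<in> pres_class R u"
    by (simp add: pres_class_def pres_eq.refl)
  then show "pres_eq R u v" by (simp add: pres_class_def)
next
  assume "pres_eq R u v"
  then show "pres_class R u = pres_class R v"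
    unfolding pres_class_def by (blast intro: pres_eq.sym pres_eq.trans)
qed

lemma pres_eq_append_left: "pres_eq R u v \<Longrightarrow> pres_eq R (w @ u) (w @ v)"
proof (induction rule: pres_eq.induct)
  case (cancel u x b v)
  show ?case using pres_eq.cancel[of R "w @ u" x b v] by simp
next
  case (rel l r u v)
  then show ?case using pres_eq.rel[of l r R "w @ u" v] by simp
next
  case (trans u v w)
  show ?case by (rule pres_eq.trans[OF trans.IH])
qed (simp_all add: pres_eq.refl pres_eq.sym)

lemma pres_eq_append_right: "pres_eq R u v \<Longrightarrow> pres_eq R (u @ w) (v @ w)"
proof (induction rule: pres_eq.induct)
  case (cancel u x b v)
  show ?case using pres_eq.cancel[of R u x b "v @ w"] by simp
next
  case (rel l r u v)
  then show ?case using pres_eq.rel[of l r R u "v @ w"] by simp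
next
  case (trans u v w)
  show ?case by (rule pres_eq.trans[OF trans.IH])
qed (simp_all add: pres_eq.refl pres_eq.sym)

lemma pres_mult:
  "pres_class R u \<otimes>\<^bsub>presented_group R\<^esub> pres_class R v = pres_class R (u @ v)"
proof -
  have *: "pres_class R (a @ b) = pres_class R (u @ v)"
    if "a \<in> pres_class R u" "b \<in> pres_class R v" for a b
  proof -
    have "pres_eq R u a" "pres_eq R v b" using that by (simp_all add: pres_class_def)
    then have "pres_eq R (u @ v) (a @ v)" "pres_eq R (a @ v) (a @ b)"
      by (simp_all add: pres_eq_append_left pres_eq_append_right)
    then have "pres_eq R (u @ v) (a @ b)" by (rule pres_eq.trans)
    then show ?thesis by (simp add: pres_class_eq_iff pres_eq.sym)
  qed
  have "u \<in> pres_class R u" "v \<in> pres_class R v"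
    by (simp_all add: pres_class_def pres_eq.refl)
  then have "(\<Union>a\<in>pres_class R u. \<Union>b\<in>pres_class R v. pres_class R (u @ v)) = pres_class R (u @ v)"
    by blast
  moreover have "(\<Union>a\<in>pres_class R u. \<Union>b\<in>pres_class R v. pres_class R (a @ b)) =
      (\<Union>a\<in>pres_class R u. \<Union>b\<in>pres_class R v. pres_class R (u @ v))"
    by (intro SUP_cong HOL.refl *)
  ultimately show ?thesis
    unfolding presented_group_def by simp
qed

lemma pres_eq_inv: "pres_eq R (gword_inv w @ w) []"
proof (induction w)
  case Nil
  show ?case by (simp add: gword_inv_def pres_eq.refl)
next
  case (Cons a w)
  obtain x b where a: "a = (x, b)" by force
  have "pres_eq R (gword_inv w @ [(x, \<not> b), (x, \<not> \<not> b)] @ w) (gword_inv w @ w)"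
    by (rule pres_eq.cancel)
  then have "pres_eq R (gword_inv (a # w) @ a # w) (gword_inv w @ w)"
    by (simp add: a gword_inv_def)
  then show ?case using Cons by (rule pres_eq.trans)
qed

lemma group_presented_group: "group (presented_group R)"
proof (rule groupI)
  fix X assume "X \<in> carrier (presented_group R)"
  then obtain u where X: "X = pres_class R u" by (auto simp: presented_group_def)
  have one: "\<one>\<^bsub>presented_group R\<^esub> = pres_class R []" by (simp add: presented_group_def)
  show "\<one>\<^bsub>presented_group R\<^esub> \<otimes>\<^bsub>presented_group R\<^esub> X = X"
    by (simp add: X one pres_mult)
  have "pres_class R (gword_inv u) \<otimes>\<^bsub>presented_group R\<^esub> X = \<one>\<^bsub>presented_group R\<^esub>"
    by (simp add: X one pres_mult pres_class_eq_iff pres_eq_inv)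
  then show "\<exists>Y\<in>carrier (presented_group R).
      Y \<otimes>\<^bsub>presented_group R\<^esub> X = \<one>\<^bsub>presented_group R\<^esub>"
    by (auto simp: presented_group_def)
next
  fix X Y assume "X \<in> carrier (presented_group R)" "Y \<in> carrier (presented_group R)"
  then obtain u v where "X = pres_class R u" "Y = pres_class R v"
    by (auto simp: presented_group_def)
  then show "X \<otimes>\<^bsub>presented_group R\<^esub> Y \<in> carrier (presented_group R)"
    by (simp add: pres_mult) (simp add: presented_group_def)
next
  fix X Y Z
  assume "X \<in> carrier (presented_group R)" "Y \<in> carrier (presented_group R)"
    "Z \<in> carrier (presented_group R)"
  then obtain u v w where "X = pres_class R u" "Y = pres_class R v" "Z = pres_class R w"
    by (auto simp: presented_group_def)
  then show "X \<otimes>\<^bsub>presented_group R\<^esub> Y \<otimes>\<^bsub>presented_group R\<^esub> Z =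
      X \<otimes>\<^bsub>presented_group R\<^esub> (Y \<otimes>\<^bsub>presented_group R\<^esub> Z)"
    by (simp add: pres_mult)
qed (simp add: presented_group_def)

lemma presented_group_relation:
  assumes "(l, r) \<in> R"
  shows "pres_class R l = pres_class R r"
  using pres_eq.rel[OF assms, of "[]" "[]"] by (simp add: pres_class_eq_iff)

definition gword_eval :: "('b, 'c) monoid_scheme \<Rightarrow> ('a \<Rightarrow> 'b) \<Rightarrow> 'a gword \<Rightarrow> 'b" where
  "gword_eval K f w =
     foldr (\<lambda>(x, b) y. (if b then f x else inv\<^bsub>K\<^esub> f x) \<otimes>\<^bsub>K\<^esub> y) w \<one>\<^bsub>K\<^esub>"

lemma presented_group_universal:
  assumes K: "group K" and f: "\<And>x. f x \<in> carrier K"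
    and R: "\<And>l r. (l, r) \<in> R \<Longrightarrow> gword_eval K f l = gword_eval K f r"
  shows "\<exists>h \<in> hom (presented_group R) K. \<forall>w. h (pres_class R w) = gword_eval K f w"
proof -
  interpret group K by (rule K)
  have cl: "gword_eval K f w \<in> carrier K" for w
    by (induction w) (auto simp: gword_eval_def f)
  have app: "gword_eval K f (u @ v) = gword_eval K f u \<otimes>\<^bsub>K\<^esub> gword_eval K f v" for u v
  proof (induction u)
    case Nil
    show ?case using cl[of v] by (simp add: gword_eval_def)
  next
    case (Cons a u)
    then show ?case using cl[of u] cl[of v] f[of "fst a"]
      by (auto simp: gword_eval_def split_beta m_assoc)
  qed
  have canc: "gword_eval K f [(x, b), (x, \<not> b)] = \<one>\<^bsub>K\<^esub>" for x b
    using f[of x] by (auto simp: gword_eval_def)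
  have inv: "gword_eval K f u = gword_eval K f v" if "pres_eq R u v" for u v
    using that
  proof (induction rule: pres_eq.induct)
    case (cancel u x b v)
    show ?case unfolding app canc using cl by simp
  next
    case (rel l r u v)
    then show ?case using R[of l r] by (simp only: app)
  qed simp_all
  define h where "h X = gword_eval K f (SOME w. w \<in> X)" for X
  have h: "h (pres_class R w) = gword_eval K f w" for w
  proof -
    have "w \<in> pres_class R w" by (simp add: pres_class_def pres_eq.refl)
    then have "(SOME v. v \<in> pres_class R w) \<in> pres_class R w" by (rule someI)
    then show ?thesis unfolding h_def using inv by (auto simp: pres_class_def)
  qed
  have "h \<in> hom (presented_group R) K"
  proof (rule homI)
    fix X assume "X \<in> carrier (presented_group R)"
    then show "h X \<in> carrier K" by (auto simp: presented_group_def h cl)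
  next
    fix X Y assume "X \<in> carrier (presented_group R)" "Y \<in> carrier (presented_group R)"
    then obtain u v where "X = pres_class R u" "Y = pres_class R v"
      by (auto simp: presented_group_def)
    then show "h (X \<otimes>\<^bsub>presented_group R\<^esub> Y) = h X \<otimes>\<^bsub>K\<^esub> h Y"
      by (simp add: pres_mult h app)
  qed
  with h show ?thesis by blast
qed


section \<open>The transfer map\<close>

definition is_transversal :: "('a, 'b) monoid_scheme \<Rightarrow> 'a set \<Rightarrow> 'a set \<Rightarrow> bool" where
  "is_transversal G K X \<longleftrightarrow>
     X \<subseteq> carrier G \<and> (\<forall>C \<in> rcosets\<^bsub>G\<^esub> K. \<exists>!x. x \<in> X \<and> x \<in> C)"

text \<open>\<open>derived G H\<close> is generated by the elements \<open>h k h\<^sup>-\<^sup>1 k\<^sup>-\<^sup>1\<close> with \<open>h, k \<in> H\<close>; replacing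
  \<open>h, k\<close> by their inverses shows that these are the same elements as \<open>[h, k] = h\<^sup>-\<^sup>1 k\<^sup>-\<^sup>1 h k\<close>.\<close>

abbreviation abelianization :: "('a, 'b) monoid_scheme \<Rightarrow> 'a set \<Rightarrow> 'a set monoid" where
  "abelianization G H \<equiv> G\<lparr>carrier := H\<rparr> Mod derived G H"

abbreviation cyclic_mult :: "('a, 'b) monoid_scheme \<Rightarrow> 'a set \<Rightarrow> 'a \<Rightarrow> 'a set" where
  "cyclic_mult G H g \<equiv> generate G {g} <#>\<^bsub>G\<^esub> H"

definition transfer_formula ::
    "('a, 'b) monoid_scheme \<Rightarrow> 'a set \<Rightarrow> 'a \<Rightarrow> 'a set \<Rightarrow> 'a set" where
  "transfer_formula G H g X =
     (let f = card (rcosets\<^bsub>G\<lparr>carrier := cyclic_mult G H g\<rparr>\<^esub> H)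
      in finprod (abelianization G H)
           (\<lambda>x. derived G H #>\<^bsub>G\<^esub> (inv\<^bsub>G\<^esub> x \<otimes>\<^bsub>G\<^esub> g [^]\<^bsub>G\<^esub> f \<otimes>\<^bsub>G\<^esub> x)) X)"

text \<open>For \<open>H\<close> normal of finite index the value of \<open>transfer_formula\<close> depends neither on the choice of
  \<open>g\<close> in the coset \<open>A\<close> of \<open>G'\<close> nor on the choice of representatives, so an arbitrary choice is made.
  Right cosets of \<open>\<langle>g\<rangle>H\<close> are the ones for which independence of the representatives holds in general;
  when \<open>G / H\<close> is abelian they agree with the left cosets.\<close>

definition transfer :: "('a, 'b) monoid_scheme \<Rightarrow> 'a set \<Rightarrow> 'a set \<Rightarrow> 'a set" where
  "transfer G H A =
     (let g = (SOME g. g \<in> A);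
          X = (SOME X. is_transversal G (cyclic_mult G H g) X)
      in transfer_formula G H g X)"

definition transfer_kernel :: "('a, 'b) monoid_scheme \<Rightarrow> 'a set \<Rightarrow> 'a set set" where
  "transfer_kernel G H =
     kernel (G Mod derived G (carrier G)) (abelianization G H) (transfer G H)"


section \<open>The groups \<open>G\<^sub>n\<close> and their subgroups\<close>

datatype gen = Sg | Tg | Rg

definition Gn_relations :: "nat \<Rightarrow> (gen gword \<times> gen gword) set" where
  "Gn_relations n =
     (let s = [(Sg, True)]; t = [(Tg, True)]; r = [(Rg, True)]
      in {(gword_pow r 4, []),
          (gword_pow s 8, []),
          (gword_pow t (2 ^ (n + 2)), []),
          (gword_pow s 4, gword_pow t (2 ^ (n + 1))),
          (gword_pow r 2, gword_pow t (2 ^ n) @ gword_pow s 2),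
          (gword_comm t s, []),
          (gword_comm r s, gword_inv (gword_pow s 2)),
          (gword_comm r t, gword_pow t 2)})"

definition Gn :: "nat \<Rightarrow> gen gword set monoid" where
  "Gn n = presented_group (Gn_relations n)"

definition \<sigma> :: "nat \<Rightarrow> gen gword set" where
  "\<sigma> n = pres_class (Gn_relations n) [(Sg, True)]"

definition \<tau> :: "nat \<Rightarrow> gen gword set" where
  "\<tau> n = pres_class (Gn_relations n) [(Tg, True)]"

definition \<rho> :: "nat \<Rightarrow> gen gword set" where
  "\<rho> n = pres_class (Gn_relations n) [(Rg, True)]"

definition H2 :: "nat \<Rightarrow> nat \<Rightarrow> gen gword set set" where
  "H2 n i =
     (let s = \<sigma> n; t = \<tau> n; r = \<rho> n;
          st = s \<otimes>\<^bsub>Gn n\<^esub> t; sr = s \<otimes>\<^bsub>Gn n\<^esub> r; tr = t \<otimes>\<^bsub>Gn n\<^esub> r;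
          s2 = s [^]\<^bsub>Gn n\<^esub> (2::nat); t2 = t [^]\<^bsub>Gn n\<^esub> (2::nat)
      in generate (Gn n)
          ([{s, t},
            if n = 1 then {s, r} else {s, t2, r},
            {r, t},
            if n = 1 then {st, r, s2} else {st, r},
            {sr, t},
            if n = 1 then {tr, s} else {tr, s, t2},
            if n = 1 then {st, tr, s2} else {st, tr}] ! (i - 1)))"

definition H4 :: "nat \<Rightarrow> nat \<Rightarrow> gen gword set set" where
  "H4 n i =
     (let s = \<sigma> n; t = \<tau> n; r = \<rho> n;
          st = s \<otimes>\<^bsub>Gn n\<^esub> t; sr = s \<otimes>\<^bsub>Gn n\<^esub> r; tr = t \<otimes>\<^bsub>Gn n\<^esub> r;
          str = s \<otimes>\<^bsub>Gn n\<^esub> t \<otimes>\<^bsub>Gn n\<^esub> r;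
          s2 = s [^]\<^bsub>Gn n\<^esub> (2::nat); t2 = t [^]\<^bsub>Gn n\<^esub> (2::nat)
      in generate (Gn n)
          ([{s, t2}, {t, s2}, {r, t2}, {st, s2}, {sr, t2}, {tr, t2}, {str, t2}] ! (i - 1)))"

abbreviation Gn_ab :: "nat \<Rightarrow> gen gword set set monoid" where
  "Gn_ab n \<equiv> Gn n Mod derived (Gn n) (carrier (Gn n))"

text \<open>The subgroup of \<open>G\<^sub>n / G\<^sub>n'\<close> generated by the cosets \<open>x G\<^sub>n'\<close> with \<open>x \<in> S\<close>.\<close>

definition gen_ab :: "nat \<Rightarrow> gen gword set set \<Rightarrow> gen gword set set set" where
  "gen_ab n S = generate (Gn_ab n) ((\<lambda>x. derived (Gn n) (carrier (Gn n)) #>\<^bsub>Gn n\<^esub> x) ` S)"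

end

theory Submission
  imports Defs "HOL-Algebra.Zassenhaus"
begin

text \<open>
  Write \<open>s, t, r\<close> for the generators. The abelian subgroup \<open>A = \<langle>s, t\<rangle>\<close> has index 2, and \<open>r\<close> acts on
  it by \<open>s \<mapsto> s\<^sup>3\<close>, \<open>t \<mapsto> t\<^sup>-\<^sup>1\<close>, with \<open>r\<^sup>2 = s\<^sup>2 t\<^bsup>2^n\<^esup>\<close>. Every element is therefore of the form
  \<open>s\<^sup>i t\<^sup>j\<close> or \<open>s\<^sup>i t\<^sup>j r\<close>, and such forms are multiplied by linear arithmetic on the exponents
  (\<open>nf_mult\<close>). The derived subgroup of \<open>G\<^sub>n\<close> is \<open>\<langle>s\<^sup>2, t\<^sup>2\<rangle>\<close>, so \<open>G\<^sub>n / G\<^sub>n'\<close> is elementary abelian of order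
  8 and the class of an element is read off from the parities of its exponents. All fourteen
  subgroups contain \<open>G\<^sub>n'\<close>, hence each is the set of elements whose parity vector lies in a given
  subspace \<open>U\<close>; likewise each kernel in question is given by a linear condition on parities.

  For \<open>H\<close> of index 2 the transfer of \<open>g\<close> is the class of \<open>g\<^sup>2\<close> when \<open>g \<notin> H\<close>, and of \<open>g y\<^sup>-\<^sup>1 g y\<close> with a
  fixed \<open>y \<notin> H\<close> when \<open>g \<in> H\<close> (\<open>transfer_kernel_index2\<close>). For \<open>y \<in> {s, t}\<close> this is always some
  \<open>s\<^bsup>2i\<^esup> t\<^bsup>2j\<^esup>\<close>, and for each \<open>H\<close> other than \<open>A\<close> such an element lies in \<open>H'\<close> exactly when \<open>i\<close>, or \<open>j\<close>, or
  \<open>i + j\<close>, is even, depending on \<open>H\<close>. The difference between \<open>n = 1\<close> and \<open>n \<ge> 2\<close> comes from the summand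
  \<open>2^n\<close> that \<open>r\<^sup>2\<close> contributes to the exponent of \<open>t\<close>: half of it is odd only for \<open>n = 1\<close>.

  That \<open>H'\<close> contains enough follows from explicit commutators. That it contains no more, and in
  particular that the presentation does not collapse, requires quotients of \<open>G\<^sub>n\<close> in which the
  relevant elements survive. One family of monomial representations suffices: homomorphisms into
  \<open>\<int>/N \<wr> \<int>/2\<close> with \<open>s \<mapsto> (p, 3p)\<close>, \<open>t \<mapsto> (u, -u)\<close> and \<open>r\<close> mapped into the coset that swaps the
  coordinates (\<open>wreath_hom\<close>). For each \<open>H \<noteq> A\<close> of index 2, parameters with \<open>N = 4\<close> make the
  image of \<open>H\<close> abelian, so \<open>H'\<close> is killed, while the elements \<open>s\<^bsup>2i\<^esup> t\<^bsup>2j\<^esup>\<close> outside \<open>H'\<close> are not.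

  For \<open>H\<close> of index 4 the transfer is trivial for one of two reasons. If \<open>H \<subseteq> A\<close>, then \<open>H' = 1\<close>, and the
  product over representatives collapses to 1 because \<open>g (r\<^sup>-\<^sup>1 g r) = s\<^bsup>4a\<^esup>\<close> has square 1 for
  \<open>g = s\<^sup>a t\<^sup>b\<close> and \<open>r\<^sup>4 = 1\<close>. Otherwise \<open>H\<close> contains some \<open>s\<^sup>a t\<^sup>b r\<close>, so \<open>H'\<close> contains \<open>s\<^sup>4\<close> and \<open>t\<^sup>4\<close>, and all
  products over representatives are of the form \<open>s\<^bsup>4k\<^esup> t\<^bsup>4l\<^esup>\<close>.
\<close>


section \<open>The transfer does not depend on the representatives\<close>

lemma (in group) comm_group_abelianization:
  assumes "subgroup H G"
  shows "comm_group (abelianization G H)"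
  using group.derived_quot_is_comm_group[OF subgroup_imp_group[OF assms]]
  by (simp add: derived_consistent[OF subset_refl assms])

lemma (in group) abelianization_mult:
  assumes "subgroup H G" "a \<in> H" "b \<in> H"
  shows "(derived G H #> a) \<otimes>\<^bsub>abelianization G H\<^esub> (derived G H #> b) = derived G H #> (a \<otimes> b)"
  using normal.rcos_sum[OF derived_subgroup_is_normal[OF assms(1)], of a b] assms(2,3) by simp

lemma (in group) abelianization_carrier:
  assumes "a \<in> H"
  shows "derived G H #> a \<in> carrier (abelianization G H)"
  using assms by (auto simp: FactGroup_def RCOSETS_def)

lemma transversal_ex1:
  assumes "is_transversal G K X" "z \<in> carrier G"
  shows "\<exists>!x. x \<in> X \<and> x \<in> K #>\<^bsub>G\<^esub> z"
  using assms unfolding is_transversal_def RCOSETS_def by blast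

text \<open>Both transversals are in bijection with the set of cosets of \<open>K\<close>; match representatives of the same
  coset.\<close>

lemma (in group) transversals_bij:
  assumes K: "subgroup K G" and X: "is_transversal G K X" and Y: "is_transversal G K Y"
  shows "\<exists>f. bij_betw f X Y \<and> (\<forall>x\<in>X. f x \<in> K #> x)"
proof -
  have XG: "X \<subseteq> carrier G" and YG: "Y \<subseteq> carrier G"
    using X Y by (auto simp: is_transversal_def)
  define f where "f x = (THE y. y \<in> Y \<and> y \<in> K #> x)" for x
  have f: "f x \<in> Y \<and> f x \<in> K #> x" if "x \<in> X" for x
    unfolding f_def by (rule theI') (use that XG transversal_ex1[OF Y] in blast)
  have coset: "K #> f x = K #> x" if "x \<in> X" for x
    using repr_independence[of "f x" K x] f[OF that] that XG K by auto
  have "inj_on f X"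
  proof (rule inj_onI)
    fix x x' assume x: "x \<in> X" "x' \<in> X" and "f x = f x'"
    then have "K #> x = K #> x'" using coset by metis
    then have "x \<in> K #> x" "x' \<in> K #> x" using rcos_self[OF _ K] x XG by auto
    then show "x = x'" using transversal_ex1[OF X, of x] x XG by blast
  qed
  moreover have "f ` X = Y"
  proof (intro equalityI subsetI)
    fix y assume y: "y \<in> Y"
    then obtain x where x: "x \<in> X" "x \<in> K #> y" using transversal_ex1[OF X, of y] YG by blast
    have "K #> y = K #> x" using repr_independence[OF x(2) _ K] y YG by auto
    then have "y \<in> K #> x" using rcos_self[OF _ K, of y] y YG by auto
    then have "f x = y" using transversal_ex1[OF Y, of x] f[OF x(1)] y x(1) XG by blast
    then show "y \<in> f ` X" using x(1) by blast
  qed (use f in blast)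
  ultimately show ?thesis using f by (auto simp: bij_betw_def)
qed

lemma (in group) subgroup_cyclic_mult:
  assumes H: "H \<lhd> G" and g: "g \<in> carrier G"
  shows "subgroup (cyclic_mult G H g) G"
proof -
  have "subgroup (generate G {g}) G" using g by (intro generate_is_subgroup) auto
  then show ?thesis
    using mult_norm_subgroup[OF H] commut_normal[OF _ H] by metis
qed

lemma (in normal) cong_mod_derived:
  assumes "m \<in> H" "m' \<in> derived G H #> m" "x \<in> carrier G"
  shows "derived G H #> (inv x \<otimes> m' \<otimes> x) = derived G H #> (inv x \<otimes> m \<otimes> x)"
proof -
  interpret D: normal "derived G H" G using derived_is_normal normal_axioms by blast
  have m: "m \<in> carrier G" using assms by auto
  obtain d where d: "d \<in> derived G H" "m' = d \<otimes> m" using assms(2) by (auto simp: r_coset_def)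
  have dG: "d \<in> carrier G" using d by auto
  have "inv x \<otimes> m' \<otimes> x = (inv x \<otimes> d \<otimes> x) \<otimes> (inv x \<otimes> m \<otimes> x)"
    using assms(3) m dG d(2) by (simp add: m_assoc inv_solve_left)
      (metis inv_closed inv_solve_left m_closed)
  then have "inv x \<otimes> m' \<otimes> x \<in> derived G H #> (inv x \<otimes> m \<otimes> x)"
    using D.inv_op_closed1[OF assms(3) d(1)] by (auto simp: r_coset_def)
  then show ?thesis
    using repr_independence[OF _ _ D.subgroup_axioms] assms(3) m by simp
qed

text \<open>Conjugating \<open>g\<^sup>f\<close> by an element of \<open>\<langle>g\<rangle>H\<close> does not change its
  class modulo \<open>H'\<close>: powers of \<open>g\<close> commute with it, and conjugation by
  \<open>H\<close> only introduces a commutator of two elements of \<open>H\<close>. With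
  \<open>cong_mod_derived\<close>, this makes each factor of the transfer depend only on the coset of its
  representative.\<close>

lemma (in normal) conj_power_mod_derived:
  assumes g: "g \<in> carrier G" and f: "g [^] (f::nat) \<in> H" and k: "k \<in> cyclic_mult G H g"
  shows "inv k \<otimes> g [^] f \<otimes> k \<in> derived G H #> (g [^] f)"
proof -
  let ?m = "g [^] f"
  have m: "?m \<in> carrier G" using g by simp
  obtain z h where z: "z \<in> generate G {g}" and h: "h \<in> H" and kz: "k = z \<otimes> h"
    using k by (auto simp: set_mult_def)
  obtain i :: int where i: "z = g [^] i" using z generate_pow[OF g] by auto
  have zG: "z \<in> carrier G" "h \<in> carrier G" using i g h by auto
  have "?m \<otimes> z = z \<otimes> ?m"
    using g unfolding i by (simp add: int_pow_int[symmetric] int_pow_mult[symmetric] add.commute)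
  then have "inv z \<otimes> ?m \<otimes> z = ?m" using zG m by (simp add: m_assoc inv_solve_left')
  moreover have "inv k \<otimes> ?m \<otimes> k = inv h \<otimes> (inv z \<otimes> ?m \<otimes> z) \<otimes> h"
    using zG m unfolding kz by (simp add: inv_mult_group m_assoc)
  ultimately have "inv k \<otimes> ?m \<otimes> k = inv h \<otimes> ?m \<otimes> h" by simp
  also have "\<dots> = (inv h \<otimes> ?m \<otimes> inv (inv h) \<otimes> inv ?m) \<otimes> ?m"
    using zG m by (simp add: m_assoc)
  finally have "inv k \<otimes> ?m \<otimes> k = (inv h \<otimes> ?m \<otimes> inv (inv h) \<otimes> inv ?m) \<otimes> ?m" .
  moreover have "inv h \<otimes> ?m \<otimes> inv (inv h) \<otimes> inv ?m \<in> derived G H"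
    unfolding derived_def by (rule generate.incl) (use h f in blast)
  ultimately show ?thesis by (auto simp: r_coset_def)
qed

lemma (in normal) transfer_formula_unique:
  assumes g: "g \<in> carrier G"
    and f: "g [^] card (rcosets\<^bsub>G\<lparr>carrier := cyclic_mult G H g\<rparr>\<^esub> H) \<in> H"
    and X: "is_transversal G (cyclic_mult G H g) X"
    and Y: "is_transversal G (cyclic_mult G H g) Y"
  shows "transfer_formula G H g X = transfer_formula G H g Y"
proof -
  let ?K = "cyclic_mult G H g"
  define m where "m = g [^] card (rcosets\<^bsub>G\<lparr>carrier := ?K\<rparr>\<^esub> H)"
  define \<theta> where "\<theta> x = derived G H #> (inv x \<otimes> m \<otimes> x)" for x
  have m: "m \<in> H" "m \<in> carrier G" using f g by (auto simp: m_def)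
  have K: "subgroup ?K G" using subgroup_cyclic_mult[OF normal_axioms g] .
  interpret ab: comm_group "abelianization G H"
    using comm_group_abelianization subgroup_axioms .
  have XG: "X \<subseteq> carrier G" and YG: "Y \<subseteq> carrier G"
    using X Y by (auto simp: is_transversal_def)
  obtain \<phi> where \<phi>: "bij_betw \<phi> X Y" "\<And>x. x \<in> X \<Longrightarrow> \<phi> x \<in> ?K #> x"
    using transversals_bij[OF K X Y] by blast
  have \<theta>c: "\<theta> x \<in> carrier (abelianization G H)" if "x \<in> carrier G" for x
    unfolding \<theta>_def by (rule abelianization_carrier) (use m that inv_op_closed1 in auto)
  have eq: "\<theta> (\<phi> x) = \<theta> x" if x: "x \<in> X" for x
  proof -
    obtain k where k: "k \<in> ?K" "\<phi> x = k \<otimes> x" using \<phi>(2)[OF x] by (auto simp: r_coset_def)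
    have kG: "k \<in> carrier G" "x \<in> carrier G" using k(1) K subgroup.subset x XG by blast+
    have "inv (\<phi> x) \<otimes> m \<otimes> \<phi> x = inv x \<otimes> (inv k \<otimes> m \<otimes> k) \<otimes> x"
      using kG m unfolding k(2) by (simp add: inv_mult_group m_assoc)
    then show ?thesis
      using cong_mod_derived[OF m(1) _ kG(2)] conj_power_mod_derived[OF g _ k(1)] f
      by (simp add: \<theta>_def m_def)
  qed
  have "finprod (abelianization G H) \<theta> Y = finprod (abelianization G H) \<theta> (\<phi> ` X)"
    using \<phi>(1) by (simp add: bij_betw_def)
  also have "\<dots> = finprod (abelianization G H) (\<lambda>x. \<theta> (\<phi> x)) X"
    using \<phi>(1) YG \<theta>c by (intro ab.finprod_reindex) (auto simp: bij_betw_def)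
  also have "\<dots> = finprod (abelianization G H) \<theta> X"
    using eq XG \<theta>c by (intro ab.finprod_cong') auto
  finally show ?thesis
    unfolding transfer_formula_def Let_def m_def[symmetric] \<theta>_def by simp
qed

text \<open>For a list of representatives, the product of the conjugates \<open>x\<^sup>-\<^sup>1 m x\<close> formed in the
  group itself, of which the transfer is the class modulo \<open>H'\<close>. Lists fix an order of the factors,
  which only becomes irrelevant modulo \<open>H'\<close>.\<close>

fun (in monoid) conj_prod :: "'a \<Rightarrow> 'a list \<Rightarrow> 'a" where
  "conj_prod m [] = \<one>"
| "conj_prod m (x # xs) = (inv x \<otimes> m \<otimes> x) \<otimes> conj_prod m xs"

lemma (in normal) conj_prod_closed:
  "m \<in> H \<Longrightarrow> set xs \<subseteq> carrier G \<Longrightarrow> conj_prod m xs \<in> H"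
  by (induction xs) (auto intro: inv_op_closed1)

lemma (in normal) finprod_conj:
  assumes "m \<in> H" "set xs \<subseteq> carrier G" "distinct xs"
  shows "finprod (abelianization G H) (\<lambda>x. derived G H #> (inv x \<otimes> m \<otimes> x)) (set xs)
       = derived G H #> conj_prod m xs"
proof -
  interpret ab: comm_group "abelianization G H"
    using comm_group_abelianization subgroup_axioms .
  have c: "derived G H #> (inv x \<otimes> m \<otimes> x) \<in> carrier (abelianization G H)" if "x \<in> carrier G" for x
    by (rule abelianization_carrier) (use assms that inv_op_closed1 in auto)
  show ?thesis using assms(2,3)
  proof (induction xs)
    case Nil
    have "derived G H #> \<one> = derived G H" 
      by (rule coset_mult_one) (use derived_in_carrier subset in auto)
    then show ?case using ab.finprod_empty by (simp add: FactGroup_def del: ab.finprod_empty)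
  next
    case (Cons x xs)
    have "finprod (abelianization G H) (\<lambda>x. derived G H #> (inv x \<otimes> m \<otimes> x)) (set (x # xs))
        = (derived G H #> (inv x \<otimes> m \<otimes> x)) \<otimes>\<^bsub>abelianization G H\<^esub> (derived G H #> conj_prod m xs)"
      using Cons c by (simp add: subset_iff)
    also have "\<dots> = derived G H #> ((inv x \<otimes> m \<otimes> x) \<otimes> conj_prod m xs)"
      using Cons.prems assms(1) by (intro abelianization_mult subgroup_axioms conj_prod_closed inv_op_closed1) auto
    finally show ?case by simp
  qed
qed

text \<open>The two arbitrary choices in the definition of the transfer are discharged here: the predicate is determined for
  every element \<open>g\<close> of a coset, and for each \<open>g\<close> any convenient list of
  representatives may be used.\<close>

lemma (in normal) transfer_kernel_eq:
  assumes ys: "\<And>g. g \<in> carrier G \<Longrightarrow>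
        \<exists>ys. distinct ys \<and> is_transversal G (cyclic_mult G H g) (set ys) \<and> 
          g [^] card (rcosets\<^bsub>G\<lparr>carrier := cyclic_mult G H g\<rparr>\<^esub> H) \<in> H \<and>
          (conj_prod (g [^] card (rcosets\<^bsub>G\<lparr>carrier := cyclic_mult G H g\<rparr>\<^esub> H)) ys \<in> derived G H \<longleftrightarrow> P g)"
    and P: "\<And>g g'. g \<in> carrier G \<Longrightarrow> g' \<in> derived G (carrier G) #> g \<Longrightarrow> P g' = P g"
  shows "transfer_kernel G H = (\<lambda>g. derived G (carrier G) #> g) ` {g \<in> carrier G. P g}"
proof -
  let ?D = "derived G (carrier G)"
  have D: "subgroup ?D G" using derived_is_subgroup by simp
  have D': "subgroup (derived G H) G" using derived_is_subgroup subset by simp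
  have key: "transfer G H (?D #> g) = derived G H \<longleftrightarrow> P g" if g: "g \<in> carrier G" for g
  proof -
    define g' where "g' = (SOME g'. g' \<in> ?D #> g)"
    have g': "g' \<in> ?D #> g" unfolding g'_def by (rule someI[of _ g]) (rule rcos_self[OF g D])
    have g'G: "g' \<in> carrier G" using g' g D by (meson is_group subgroup.elemrcos_carrier)
    define m where "m = g' [^] card (rcosets\<^bsub>G\<lparr>carrier := cyclic_mult G H g'\<rparr>\<^esub> H)"
    obtain ys where y: "distinct ys" "is_transversal G (cyclic_mult G H g') (set ys)"
       and m: "m \<in> H" "conj_prod m ys \<in> derived G H \<longleftrightarrow> P g'"
      using ys[OF g'G] unfolding m_def by blast
    have yG: "set ys \<subseteq> carrier G" using y by (auto simp: is_transversal_def)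
    have "transfer G H (?D #> g) = transfer_formula G H g' (SOME X. is_transversal G (cyclic_mult G H g') X)"
      by (simp add: transfer_def g'_def Let_def)
    also have "\<dots> = transfer_formula G H g' (set ys)"
      by (rule transfer_formula_unique[OF g'G]) (use y m m_def in \<open>auto intro: someI\<close>)
    also have "\<dots> = derived G H #> conj_prod m ys"
      using finprod_conj[OF m(1) yG y(1)] by (simp add: transfer_formula_def m_def Let_def)
    finally have "transfer G H (?D #> g) = derived G H \<longleftrightarrow> conj_prod m ys \<in> derived G H"
      using coset_join1[OF _ _ D'] coset_join2[OF _ D'] conj_prod_closed[OF m(1) yG] by auto
    then show ?thesis using m P[OF g g'] by simp
  qed
  have "transfer_kernel G H = {A \<in> (\<lambda>g. ?D #> g) ` carrier G. transfer G H A = derived G H}"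
    by (auto simp: transfer_kernel_def kernel_def FactGroup_def RCOSETS_def)
  then show ?thesis using key by auto
qed


section \<open>Subgroups that contain the kernel of a map onto an elementary abelian 2-group\<close>

text \<open>The target \<open>E\<close> is an elementary abelian 2-group. For a subgroup \<open>H\<close> that is the
  preimage of a subgroup \<open>U\<close> of \<open>E\<close>, everything that the transfer formula asks about
  cosets of \<open>H\<close> and of \<open>\<langle>g\<rangle>H\<close> becomes a question about
  \<open>U\<close> and \<open>\<pi> g\<close>.\<close>

locale exp2_hom = G: group G + E: comm_group E for G (structure) and E (structure) +
  fixes \<pi>
  assumes hom: "\<pi> \<in> hom G E"
    and sq: "e \<in> carrier E \<Longrightarrow> e \<otimes>\<^bsub>E\<^esub> e = \<one>\<^bsub>E\<^esub>"
begin

sublocale group_hom G E \<pi>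
  by unfold_locales (rule hom)

definition preim :: "'c set \<Rightarrow> 'a set" where
  "preim U = {g \<in> carrier G. \<pi> g \<in> U}"

lemma inv_self: "e \<in> carrier E \<Longrightarrow> inv\<^bsub>E\<^esub> e = e"
  using sq by (simp add: E.inv_equality)

lemma sq_left:
  "e \<in> carrier E \<Longrightarrow> x \<in> carrier E \<Longrightarrow> e \<otimes>\<^bsub>E\<^esub> (e \<otimes>\<^bsub>E\<^esub> x) = x"
  by (simp add: E.m_assoc[symmetric] sq)

lemma cancel_mem:
  assumes "subgroup U E" "a \<in> U" "b \<in> carrier E"
  shows "a \<otimes>\<^bsub>E\<^esub> b \<in> U \<longleftrightarrow> b \<in> U" "b \<otimes>\<^bsub>E\<^esub> a \<in> U \<longleftrightarrow> b \<in> U"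
proof -
  have a: "a \<in> carrier E" using assms subgroup.mem_carrier by metis
  show *: "a \<otimes>\<^bsub>E\<^esub> b \<in> U \<longleftrightarrow> b \<in> U"
    using sq_left[OF a assms(3)] subgroup.m_closed[OF assms(1,2)] by metis
  show "b \<otimes>\<^bsub>E\<^esub> a \<in> U \<longleftrightarrow> b \<in> U" using * E.m_comm[OF a assms(3)] by simp
qed

lemma preim_normal:
  assumes "subgroup U E" shows "preim U \<lhd> G"
proof (rule G.normal_invI)
  show "subgroup (preim U) G"
    using assms
    by (intro G.subgroupI)
      (auto simp: preim_def subgroup.m_closed subgroup.m_inv_closed intro!: exI[of _ \<one>] dest: subgroup.one_closed)
next
  fix x h assume "x \<in> carrier G" "h \<in> preim U"
  then show "x \<otimes> h \<otimes> inv x \<in> preim U"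
    by (auto simp: preim_def inv_self E.m_ac sq_left sq)
qed

lemma cyclic_mult_preim:
  assumes U: "subgroup U E" and g: "g \<in> carrier G"
  shows "cyclic_mult G (preim U) g = {k \<in> carrier G. \<pi> k \<in> U \<or> \<pi> k \<otimes>\<^bsub>E\<^esub> \<pi> g \<in> U}"
proof (intro equalityI subsetI)
  fix k assume "k \<in> cyclic_mult G (preim U) g"
  then obtain z h where z: "z \<in> generate G {g}" and h: "h \<in> preim U" and k: "k = z \<otimes> h"
    by (auto simp: set_mult_def)
  have zG: "z \<in> carrier G" using z g G.generate_in_carrier[of "{g}"] by auto
  have "\<pi> z = \<one>\<^bsub>E\<^esub> \<or> \<pi> z = \<pi> g"
    using z
  proof (induction rule: generate.induct)
    case (eng z1 z2)
    moreover have "z1 \<in> carrier G" "z2 \<in> carrier G" using eng.hyps g G.generate_in_carrier[of "{g}"] by auto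
    ultimately show ?case using g by (auto simp: sq)
  qed (use g in \<open>auto simp: inv_self\<close>)
  then show "k \<in> {k \<in> carrier G. \<pi> k \<in> U \<or> \<pi> k \<otimes>\<^bsub>E\<^esub> \<pi> g \<in> U}"
    using h zG g by (auto simp: k preim_def E.m_ac sq_left)
next
  fix k assume k: "k \<in> {k \<in> carrier G. \<pi> k \<in> U \<or> \<pi> k \<otimes>\<^bsub>E\<^esub> \<pi> g \<in> U}"
  show "k \<in> cyclic_mult G (preim U) g"
  proof (cases "\<pi> k \<in> U")
    case True
    then have "k = \<one> \<otimes> k" "k \<in> preim U" using k by (auto simp: preim_def)
    then show ?thesis unfolding set_mult_def using generate.one by blast
  next
    case False
    then have "k = g \<otimes> (inv g \<otimes> k)" "inv g \<otimes> k \<in> preim U"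
      using k g by (auto simp: preim_def inv_self E.m_comm G.m_assoc[symmetric])
    then show ?thesis unfolding set_mult_def using generate.incl[of g "{g}" G] by blast
  qed
qed

lemma rcoset_preim:
  assumes U: "subgroup U E" and g: "g \<in> carrier G"
  shows "preim U #> g = {x \<in> carrier G. \<pi> x \<otimes>\<^bsub>E\<^esub> \<pi> g \<in> U}"
proof (intro equalityI subsetI)
  fix x assume "x \<in> preim U #> g"
  then show "x \<in> {x \<in> carrier G. \<pi> x \<otimes>\<^bsub>E\<^esub> \<pi> g \<in> U}"
    using g by (auto simp: r_coset_def preim_def E.m_assoc sq)
next
  fix x assume x: "x \<in> {x \<in> carrier G. \<pi> x \<otimes>\<^bsub>E\<^esub> \<pi> g \<in> U}"
  then have "x = (x \<otimes> inv g) \<otimes> g" "x \<otimes> inv g \<in> preim U"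
    using g by (auto simp: preim_def inv_self G.m_assoc)
  then show "x \<in> preim U #> g" unfolding r_coset_def by blast
qed

lemma card_rcosets_preim:
  assumes U: "subgroup U E" and g: "g \<in> carrier G"
  shows "card (rcosets\<^bsub>G\<lparr>carrier := cyclic_mult G (preim U) g\<rparr>\<^esub> (preim U))
     = (if \<pi> g \<in> U then 1 else 2)"
proof -
  have one: "preim U = {x \<in> carrier G. \<pi> x \<otimes>\<^bsub>E\<^esub> \<one>\<^bsub>E\<^esub> \<in> U}" by (auto simp: preim_def)
  have coset: "preim U #> k = (if \<pi> k \<in> U then preim U else preim U #> g)"
    if k: "k \<in> carrier G" "\<pi> k \<in> U \<or> \<pi> k \<otimes>\<^bsub>E\<^esub> \<pi> g \<in> U" for k
  proof (cases "\<pi> k \<in> U")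
    case True
    then show ?thesis unfolding rcoset_preim[OF U k(1)]
      using cancel_mem[OF U True] by (auto simp: preim_def)
  next
    case False
    have "\<pi> x \<otimes>\<^bsub>E\<^esub> \<pi> k \<in> U \<longleftrightarrow> \<pi> x \<otimes>\<^bsub>E\<^esub> \<pi> g \<in> U" if x: "x \<in> carrier G" for x
    proof -
      have "(\<pi> k \<otimes>\<^bsub>E\<^esub> \<pi> g) \<otimes>\<^bsub>E\<^esub> (\<pi> x \<otimes>\<^bsub>E\<^esub> \<pi> k) = \<pi> x \<otimes>\<^bsub>E\<^esub> \<pi> g"
        using x k g by (simp add: E.m_ac sq_left)
      then show ?thesis using cancel_mem(1)[OF U, of "\<pi> k \<otimes>\<^bsub>E\<^esub> \<pi> g" "\<pi> x \<otimes>\<^bsub>E\<^esub> \<pi> k"] k x False by auto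
    qed
    then show ?thesis using False by (auto simp: rcoset_preim[OF U] k(1) g)
  qed
  have "rcosets\<^bsub>G\<lparr>carrier := cyclic_mult G (preim U) g\<rparr>\<^esub> (preim U)
      = (\<lambda>k. preim U #> k) ` {k \<in> carrier G. \<pi> k \<in> U \<or> \<pi> k \<otimes>\<^bsub>E\<^esub> \<pi> g \<in> U}"
    by (auto simp: RCOSETS_def cyclic_mult_preim[OF U g])
  also have "\<dots> = {preim U, preim U #> g}" (is "?f ` ?K = _")
  proof (intro equalityI subsetI)
    fix C assume "C \<in> ?f ` ?K"
    then show "C \<in> {preim U, preim U #> g}" using coset by (auto split: if_splits)
  next
    fix C assume C: "C \<in> {preim U, preim U #> g}"
    have "\<one> \<in> ?K" "g \<in> ?K" using g subgroup.one_closed[OF U] by (auto simp: sq)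
    moreover have "preim U = ?f \<one>" using coset[of \<one>] subgroup.one_closed[OF U] by simp
    ultimately show "C \<in> ?f ` ?K" using C by blast
  qed
  finally have *: "rcosets\<^bsub>G\<lparr>carrier := cyclic_mult G (preim U) g\<rparr>\<^esub> (preim U) = {preim U, preim U #> g}" .
  show ?thesis
  proof (cases "\<pi> g \<in> U")
    case True
    then show ?thesis using coset[of g] g by (simp add: *)
  next
    case False
    have "\<one> \<in> preim U" using subgroup.one_closed[OF U] by (simp add: preim_def)
    moreover have "\<one> \<notin> preim U #> g" using False g by (simp add: rcoset_preim[OF U g])
    ultimately have "preim U \<noteq> preim U #> g" by blast
    then show ?thesis using False by (simp add: *)
  qed
qed

lemma is_transversal_preim:
  assumes U: "subgroup U E" and g: "g \<in> carrier G" and X: "X \<subseteq> carrier G"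
    and ex1: "\<And>e. e \<in> carrier E \<Longrightarrow>
       \<exists>!x. x \<in> X \<and> (\<pi> x \<otimes>\<^bsub>E\<^esub> e \<in> U \<or> \<pi> x \<otimes>\<^bsub>E\<^esub> e \<otimes>\<^bsub>E\<^esub> \<pi> g \<in> U)"
  shows "is_transversal G (cyclic_mult G (preim U) g) X"
  unfolding is_transversal_def
proof (intro conjI ballI)
  fix C assume "C \<in> rcosets (cyclic_mult G (preim U) g)"
  then obtain z where z: "z \<in> carrier G" and C: "C = cyclic_mult G (preim U) g #> z"
    by (auto simp: RCOSETS_def)
  have "x \<in> C \<longleftrightarrow> \<pi> x \<otimes>\<^bsub>E\<^esub> \<pi> z \<in> U \<or> \<pi> x \<otimes>\<^bsub>E\<^esub> \<pi> z \<otimes>\<^bsub>E\<^esub> \<pi> g \<in> U" if x: "x \<in> carrier G" for x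
  proof -
    have "subgroup (cyclic_mult G (preim U) g) G"
      by (rule G.subgroup_cyclic_mult[OF preim_normal[OF U] g])
    then have "x \<in> C \<longleftrightarrow> x \<otimes> inv z \<in> cyclic_mult G (preim U) g"
      unfolding C using subgroup.rcos_module[OF _ G.is_group z x] by blast
    then show ?thesis using x z by (simp add: cyclic_mult_preim[OF U g] inv_self)
  qed
  then show "\<exists>!x. x \<in> X \<and> x \<in> C" using ex1[of "\<pi> z"] z X by (metis hom_closed subsetD)
qed (rule X)

lemma rcoset_eq_iff:
  assumes D: "derived G (carrier G) = preim {\<one>\<^bsub>E\<^esub>}" and "g \<in> carrier G" "g' \<in> carrier G"
  shows "derived G (carrier G) #> g = derived G (carrier G) #> g' \<longleftrightarrow> \<pi> g = \<pi> g'"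
proof -
  have 1: "subgroup {\<one>\<^bsub>E\<^esub>} E" by (rule E.triv_subgroup)
  have "a \<otimes>\<^bsub>E\<^esub> b = \<one>\<^bsub>E\<^esub> \<longleftrightarrow> a = b" if "a \<in> carrier E" "b \<in> carrier E" for a b
    using that sq by (metis E.inv_equality inv_self)
  then have "derived G (carrier G) #> h = {x \<in> carrier G. \<pi> x = \<pi> h}" if "h \<in> carrier G" for h
    using that unfolding D rcoset_preim[OF 1 that] by auto
  then show ?thesis using assms(2,3) by auto
qed

text \<open>Representatives are required to have distinct images in \<open>E\<close>, so that the transversal condition can
  be checked in \<open>E\<close> alone. The exponent \<open>f\<close> of the transfer formula is 1 or 2
  according to whether \<open>g \<in> H\<close>.\<close>

lemma transfer_kernel_preim:
  assumes D: "derived G (carrier G) = preim {\<one>\<^bsub>E\<^esub>}" and U: "subgroup U E"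
    and ys: "\<And>g. g \<in> carrier G \<Longrightarrow> \<exists>ys. distinct (map \<pi> ys) \<and> set ys \<subseteq> carrier G \<and>
       (\<forall>e \<in> carrier E. \<exists>!x. x \<in> set (map \<pi> ys) \<and> (x \<otimes>\<^bsub>E\<^esub> e \<in> U \<or> x \<otimes>\<^bsub>E\<^esub> e \<otimes>\<^bsub>E\<^esub> \<pi> g \<in> U)) \<and>
       (G.conj_prod (if \<pi> g \<in> U then g else g \<otimes> g) ys \<in> derived G (preim U) \<longleftrightarrow> p (\<pi> g))"
  shows "transfer_kernel G (preim U) =
     (\<lambda>g. derived G (carrier G) #> g) ` {g \<in> carrier G. p (\<pi> g)}"
proof (rule normal.transfer_kernel_eq[OF preim_normal[OF U]])
  fix g assume g: "g \<in> carrier G"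
  let ?f = "card (rcosets\<^bsub>G\<lparr>carrier := cyclic_mult G (preim U) g\<rparr>\<^esub> (preim U))"
  have f: "g [^] ?f = (if \<pi> g \<in> U then g else g \<otimes> g)"
    using g by (simp add: card_rcosets_preim[OF U g] numeral_2_eq_2)
  have "g [^] ?f \<in> preim U" unfolding f using g subgroup.one_closed[OF U] by (auto simp: preim_def sq)
  moreover obtain ys where ys': "distinct (map \<pi> ys)" "set ys \<subseteq> carrier G"
      "G.conj_prod (if \<pi> g \<in> U then g else g \<otimes> g) ys \<in> derived G (preim U) \<longleftrightarrow> p (\<pi> g)"
    and ex1: "\<forall>e \<in> carrier E. \<exists>!x. x \<in> set (map \<pi> ys) \<and>
       (x \<otimes>\<^bsub>E\<^esub> e \<in> U \<or> x \<otimes>\<^bsub>E\<^esub> e \<otimes>\<^bsub>E\<^esub> \<pi> g \<in> U)"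
    using ys[OF g] by (elim exE conjE) (rule that)
  moreover have "distinct ys" using ys'(1) by (simp add: distinct_map)
  moreover have "is_transversal G (cyclic_mult G (preim U) g) (set ys)"
  proof (rule is_transversal_preim[OF U g ys'(2)])
    fix e assume "e \<in> carrier E"
    from bspec[OF ex1 this] obtain y where y: "y \<in> set (map \<pi> ys)" "y \<otimes>\<^bsub>E\<^esub> e \<in> U \<or> y \<otimes>\<^bsub>E\<^esub> e \<otimes>\<^bsub>E\<^esub> \<pi> g \<in> U"
      and u: "\<And>x'. x' \<in> set (map \<pi> ys) \<Longrightarrow>
          x' \<otimes>\<^bsub>E\<^esub> e \<in> U \<or> x' \<otimes>\<^bsub>E\<^esub> e \<otimes>\<^bsub>E\<^esub> \<pi> g \<in> U \<Longrightarrow> x' = y"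
      by (elim ex1E) blast
    obtain x where x: "x \<in> set ys" "y = \<pi> x" using y(1) by auto
    show "\<exists>!x. x \<in> set ys \<and> (\<pi> x \<otimes>\<^bsub>E\<^esub> e \<in> U \<or> \<pi> x \<otimes>\<^bsub>E\<^esub> e \<otimes>\<^bsub>E\<^esub> \<pi> g \<in> U)"
    proof (rule ex1I[of _ x])
      fix x' assume x': "x' \<in> set ys \<and> (\<pi> x' \<otimes>\<^bsub>E\<^esub> e \<in> U \<or> \<pi> x' \<otimes>\<^bsub>E\<^esub> e \<otimes>\<^bsub>E\<^esub> \<pi> g \<in> U)"
      then have "\<pi> x' = \<pi> x" using u[of "\<pi> x'"] x(2) by simp
      then show "x' = x" using x' x(1) ys'(1) by (auto simp: distinct_map dest: inj_onD)
    qed (use x y in blast)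
  qed
  ultimately show "\<exists>ys. distinct ys \<and> is_transversal G (cyclic_mult G (preim U) g) (set ys) \<and>
      g [^] ?f \<in> preim U \<and> (G.conj_prod (g [^] ?f) ys \<in> derived G (preim U) \<longleftrightarrow> p (\<pi> g))"
    unfolding f by (intro exI[of _ ys] conjI)
next
  fix g g' assume g: "g \<in> carrier G" and g': "g' \<in> derived G (carrier G) #> g"
  have "g' \<in> carrier G" using g' unfolding D by (auto simp: r_coset_def preim_def g)
  then have "\<pi> g' = \<pi> g"
    using rcoset_eq_iff[OF D] G.repr_independence[OF g' g] g G.derived_is_subgroup by blast
  then show "p (\<pi> g') = p (\<pi> g)" by simp
qed

lemma generate_Mod_derived:
  assumes D: "derived G (carrier G) = preim {\<one>\<^bsub>E\<^esub>}" and S: "S \<subseteq> carrier G"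
  shows "generate (G Mod derived G (carrier G)) ((\<lambda>g. derived G (carrier G) #> g) ` S)
     = (\<lambda>g. derived G (carrier G) #> g) ` {g \<in> carrier G. \<pi> g \<in> generate E (\<pi> ` S)}"
proof -
  interpret D: normal "derived G (carrier G)" G by (rule G.derived_self_is_normal)
  interpret q: group_hom G "G Mod derived G (carrier G)" "\<lambda>g. derived G (carrier G) #> g"
    using D.r_coset_hom_Mod D.factorgroup_is_group by (simp add: group_hom_def group_hom_axioms_def)
  have "x \<in> carrier G" if "x \<in> generate G S" for x using that S G.generate_in_carrier by blast
  then have "(\<lambda>g. derived G (carrier G) #> g) ` generate G S
      = (\<lambda>g. derived G (carrier G) #> g) ` {g \<in> carrier G. \<pi> g \<in> \<pi> ` generate G S}"
    using rcoset_eq_iff[OF D] by blast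
  then show ?thesis unfolding q.generate_img[OF S] generate_img[OF S] .
qed

lemma generate_eq_preim:
  assumes S: "S \<subseteq> carrier G" and ker: "preim {\<one>\<^bsub>E\<^esub>} \<subseteq> generate G S"
  shows "generate G S = preim (generate E (\<pi> ` S))"
proof -
  have sub: "subgroup (generate G S) G" by (rule G.generate_is_subgroup[OF S])
  have "x \<in> generate G S" if x: "x \<in> carrier G" "y \<in> generate G S" "\<pi> x = \<pi> y" for x y
  proof -
    have y: "y \<in> carrier G" using x S G.generate_in_carrier by blast
    then have "x \<otimes> inv y \<in> preim {\<one>\<^bsub>E\<^esub>}" using x by (simp add: preim_def)
    then have "x \<otimes> inv y \<otimes> y \<in> generate G S" using ker subgroup.m_closed[OF sub _ x(2)] by blast
    then show ?thesis using x y by (simp add: G.m_assoc)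
  qed
  moreover have "x \<in> carrier G" if "x \<in> generate G S" for x using that S G.generate_in_carrier by blast
  ultimately show ?thesis unfolding generate_img[OF S] preim_def by auto
qed

text \<open>For index 2, representatives of \<open>G / \<langle>g\<rangle>H\<close> are \<open>1, y\<close> when \<open>g
  \<in> H\<close>, and just \<open>1\<close> otherwise.\<close>

lemma transfer_kernel_index2:
  assumes D: "derived G (carrier G) = preim {\<one>\<^bsub>E\<^esub>}" and U: "subgroup U E"
    and y: "y \<in> carrier G" "\<pi> y \<notin> U" and index: "\<And>e. e \<in> carrier E \<Longrightarrow> e \<in> U \<or> \<pi> y \<otimes>\<^bsub>E\<^esub> e \<in> U"
    and val_in: "\<And>g. g \<in> carrier G \<Longrightarrow> \<pi> g \<in> U \<Longrightarrow>
        g \<otimes> (inv y \<otimes> g \<otimes> y) \<in> derived G (preim U) \<longleftrightarrow> p (\<pi> g)"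
    and val_notin: "\<And>g. g \<in> carrier G \<Longrightarrow> \<pi> g \<notin> U \<Longrightarrow>
        g \<otimes> g \<in> derived G (preim U) \<longleftrightarrow> p (\<pi> g)"
  shows "transfer_kernel G (preim U) =
     (\<lambda>g. derived G (carrier G) #> g) ` {g \<in> carrier G. p (\<pi> g)}"
proof (rule transfer_kernel_preim[OF D U])
  fix g assume g: "g \<in> carrier G"
  have one: "\<one>\<^bsub>E\<^esub> \<in> U" using subgroup.one_closed[OF U] .
  then have y1: "\<one>\<^bsub>E\<^esub> \<noteq> \<pi> y" using y by force
  have idx: "\<not> (\<pi> y \<otimes>\<^bsub>E\<^esub> e \<in> U)" if "e \<in> U" for e
    using cancel_mem(2)[OF U that] y by auto
  show "\<exists>ys. distinct (map \<pi> ys) \<and> set ys \<subseteq> carrier G \<and>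
       (\<forall>e \<in> carrier E. \<exists>!x. x \<in> set (map \<pi> ys) \<and> (x \<otimes>\<^bsub>E\<^esub> e \<in> U \<or> x \<otimes>\<^bsub>E\<^esub> e \<otimes>\<^bsub>E\<^esub> \<pi> g \<in> U)) \<and>
       (G.conj_prod (if \<pi> g \<in> U then g else g \<otimes> g) ys \<in> derived G (preim U) \<longleftrightarrow> p (\<pi> g))"
  proof (cases "\<pi> g \<in> U")
    case True
    have "\<exists>!x. x \<in> set (map \<pi> [\<one>, y]) \<and> (x \<otimes>\<^bsub>E\<^esub> e \<in> U \<or> x \<otimes>\<^bsub>E\<^esub> e \<otimes>\<^bsub>E\<^esub> \<pi> g \<in> U)"
      if e: "e \<in> carrier E" for e
      using index[OF e] idx[of e] e y by (auto simp: cancel_mem(2)[OF U True])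
    then show ?thesis using val_in[OF g True] True y1 y g by (intro exI[of _ "[\<one>, y]"]) auto
  next
    case False
    have "e \<in> U \<or> e \<otimes>\<^bsub>E\<^esub> \<pi> g \<in> U" if e: "e \<in> carrier E" for e
    proof -
      have "\<pi> y \<otimes>\<^bsub>E\<^esub> \<pi> g \<in> U" using index[of "\<pi> g"] False g by auto
      moreover have "(\<pi> y \<otimes>\<^bsub>E\<^esub> \<pi> g) \<otimes>\<^bsub>E\<^esub> (\<pi> y \<otimes>\<^bsub>E\<^esub> e) = e \<otimes>\<^bsub>E\<^esub> \<pi> g"
        using y g e by (simp add: E.m_ac sq_left sq)
      ultimately show ?thesis using index[OF e] subgroup.m_closed[OF U] by metis
    qed
    then show ?thesis using val_notin[OF g False] False g by (intro exI[of _ "[\<one>]"]) (auto simp: sq)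
  qed
qed

end


section \<open>Evaluating words in a group\<close>

lemma (in group) gword_eval_closed:
  assumes "\<And>x. f x \<in> carrier G"
  shows "gword_eval G f w \<in> carrier G"
  by (induction w) (auto simp: gword_eval_def assms)

lemma (in group) gword_eval_append:
  assumes "\<And>x. f x \<in> carrier G"
  shows "gword_eval G f (u @ v) = gword_eval G f u \<otimes> gword_eval G f v"
  using gword_eval_closed[of f, OF assms]
  by (induction u) (auto simp: gword_eval_def assms m_assoc)

lemma (in group) gword_eval_pow:
  assumes "\<And>x. f x \<in> carrier G"
  shows "gword_eval G f (gword_pow w k) = gword_eval G f w [^] k"
proof (induction k)
  case 0
  show ?case by (simp add: gword_pow_def gword_eval_def)
next
  case (Suc k)
  have "gword_eval G f (gword_pow w (Suc k)) = gword_eval G f w \<otimes> gword_eval G f (gword_pow w k)"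
    by (simp add: gword_pow_def gword_eval_append[of f, OF assms])
  then show ?case using Suc nat_pow_Suc2[OF gword_eval_closed[of f, OF assms]] by simp
qed

lemma (in group) gword_eval_inv:
  assumes "\<And>x. f x \<in> carrier G"
  shows "gword_eval G f (gword_inv w) = inv (gword_eval G f w)"
proof (induction w)
  case Nil
  show ?case by (simp add: gword_inv_def gword_eval_def)
next
  case (Cons a w)
  obtain x b where a: "a = (x, b)" by force
  have "gword_eval G f (gword_inv (a # w)) = gword_eval G f (gword_inv w) \<otimes> gword_eval G f [(x, \<not> b)]"
    by (simp add: gword_inv_def a gword_eval_append[of f, OF assms])
  also have "\<dots> = inv (gword_eval G f w) \<otimes> inv (gword_eval G f [a])"
    using Cons by (auto simp: a gword_eval_def assms)
  also have "\<dots> = inv (gword_eval G f ([a] @ w))"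
    by (simp only: gword_eval_append[of f, OF assms])
      (simp add: inv_mult_group gword_eval_closed assms)
  finally show ?case by simp
qed

lemma (in group) gword_eval_letter:
  "f x \<in> carrier G \<Longrightarrow> gword_eval G f [(x, True)] = f x"
  by (simp add: gword_eval_def)

text \<open>A relation between words in a presented group is thus an equation between products of generators, to which the
  same evaluation lemmas apply as to relations checked in any other group.\<close>

lemma pres_class_eq_eval:
  "pres_class R w = gword_eval (presented_group R) (\<lambda>x. pres_class R [(x, True)]) w"
proof (induction w)
  case Nil
  show ?case by (simp add: gword_eval_def presented_group_def)
next
  case (Cons a w)
  interpret group "presented_group R" by (rule group_presented_group)
  obtain x b where a: "a = (x, b)" by force
  have cl: "pres_class R u \<in> carrier (presented_group R)" for u by (simp add: presented_group_def)
  have "pres_class R [(x, False)] = inv\<^bsub>presented_group R\<^esub> pres_class R [(x, True)]"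
    using pres_eq.cancel[of R "[]" x False "[]"]
    by (intro inv_equality[symmetric] cl) (simp add: pres_mult pres_class_eq_iff, simp add: presented_group_def pres_class_eq_iff[symmetric])
  then have "pres_class R [a] = (if b then pres_class R [(x, True)]
      else inv\<^bsub>presented_group R\<^esub> pres_class R [(x, True)])"
    by (simp add: a)
  moreover have "pres_class R (a # w) = pres_class R [a] \<otimes>\<^bsub>presented_group R\<^esub> pres_class R w"
    by (simp add: pres_mult)
  ultimately show ?case using Cons by (simp add: gword_eval_def a)
qed


section \<open>The defining relations\<close>

text \<open>The defining relations of \<open>G\<^sub>n\<close>, with the three commutator relations in inverse-free form;
  they are equivalent to the original ones by \<open>commutator_relations\<close>.\<close>

locale Gn_relators = group G for G (structure) +
  fixes n :: nat and s t r
  assumes s [simp]: "s \<in> carrier G" and t [simp]: "t \<in> carrier G" and r [simp]: "r \<in> carrier G"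
    and r4: "r [^] (4::nat) = \<one>" and s8: "s [^] (8::nat) = \<one>"
    and t_order: "t [^] (2 ^ (n + 2) :: nat) = \<one>"
    and s4: "s [^] (4::nat) = t [^] (2 ^ (n + 1) :: nat)"
    and r2: "r [^] (2::nat) = t [^] (2 ^ n :: nat) \<otimes> s [^] (2::nat)"
    and ts: "t \<otimes> s = s \<otimes> t"
    and sr: "s \<otimes> r = r \<otimes> s [^] (3::nat)"
    and trt: "t \<otimes> r \<otimes> t = r"

fun gens :: "'a \<Rightarrow> 'a \<Rightarrow> 'a \<Rightarrow> gen \<Rightarrow> 'a" where
  "gens s t r Sg = s" | "gens s t r Tg = t" | "gens s t r Rg = r"

lemma (in group) commutator_relations:
  assumes [simp]: "s \<in> carrier G" "t \<in> carrier G" "r \<in> carrier G"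
  shows "inv t \<otimes> (inv s \<otimes> (t \<otimes> s)) = \<one> \<longleftrightarrow> t \<otimes> s = s \<otimes> t"
    and "inv r \<otimes> (inv s \<otimes> (r \<otimes> s)) = inv (s [^] (2::nat)) \<longleftrightarrow> s \<otimes> r = r \<otimes> s [^] (3::nat)"
    and "inv r \<otimes> (inv t \<otimes> (r \<otimes> t)) = t [^] (2::nat) \<longleftrightarrow> t \<otimes> r \<otimes> t = r"
proof -
  show "inv t \<otimes> (inv s \<otimes> (t \<otimes> s)) = \<one> \<longleftrightarrow> t \<otimes> s = s \<otimes> t"
    by (auto simp: inv_solve_left' m_assoc)
  have "inv r \<otimes> (inv s \<otimes> (r \<otimes> s)) = inv (s [^] (2::nat)) \<longleftrightarrow>
      inv r \<otimes> (inv s \<otimes> (r \<otimes> s)) \<otimes> s [^] (2::nat) = \<one>"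
    by (metis assms inv_closed inv_equality inv_inv m_closed nat_pow_closed r_inv l_inv inv_unique')
  also have "\<dots> \<longleftrightarrow> inv r \<otimes> (inv s \<otimes> (r \<otimes> s [^] (3::nat))) = \<one>"
    by (simp add: m_assoc numeral_2_eq_2 numeral_3_eq_3)
  also have "\<dots> \<longleftrightarrow> s \<otimes> r = r \<otimes> s [^] (3::nat)"
    by (auto simp: inv_solve_left')
  finally show "inv r \<otimes> (inv s \<otimes> (r \<otimes> s)) = inv (s [^] (2::nat)) \<longleftrightarrow> s \<otimes> r = r \<otimes> s [^] (3::nat)" .
  have "inv r \<otimes> (inv t \<otimes> (r \<otimes> t)) = t [^] (2::nat) \<longleftrightarrow> r \<otimes> t = t \<otimes> (r \<otimes> (t \<otimes> t))"
    by (simp add: inv_solve_left' numeral_2_eq_2)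
  also have "\<dots> \<longleftrightarrow> t \<otimes> r \<otimes> t = r"
  proof -
    have "t \<otimes> (r \<otimes> (t \<otimes> t)) = (t \<otimes> r \<otimes> t) \<otimes> t" by (simp add: m_assoc)
    then show ?thesis by auto
  qed
  finally show "inv r \<otimes> (inv t \<otimes> (r \<otimes> t)) = t [^] (2::nat) \<longleftrightarrow> t \<otimes> r \<otimes> t = r" .
qed

lemma (in group) Gn_relators_iff_eval:
  assumes [simp]: "s \<in> carrier G" "t \<in> carrier G" "r \<in> carrier G"
  shows "Gn_relators G n s t r \<longleftrightarrow>
    (\<forall>(u, v) \<in> Gn_relations n. gword_eval G (gens s t r) u = gword_eval G (gens s t r) v)"
proof -
  have f: "gens s t r x \<in> carrier G" for x by (cases x) auto
  have nil: "gword_eval G (gens s t r) [] = \<one>" by (simp add: gword_eval_def)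
  have gen: "gword_eval G (gens s t r) [(x, True)] = gens s t r x" for x
    using f by (rule gword_eval_letter)
  show ?thesis
    unfolding Gn_relators_def Gn_relators_axioms_def Gn_relations_def Let_def gword_comm_def
    by (simp add: gword_eval_append[OF f] gword_eval_inv[OF f] gword_eval_pow[OF f] gen nil
        is_group del: append.simps One_nat_def)
      (simp add: commutator_relations[OF assms])
qed

lemma gens_Gn: "gens (\<sigma> n) (\<tau> n) (\<rho> n) = (\<lambda>x. pres_class (Gn_relations n) [(x, True)])"
proof
  fix x show "gens (\<sigma> n) (\<tau> n) (\<rho> n) x = pres_class (Gn_relations n) [(x, True)]"
    by (cases x) (auto simp: \<sigma>_def \<tau>_def \<rho>_def)
qed

lemma Gn_relators_Gn: "Gn_relators (Gn n) n (\<sigma> n) (\<tau> n) (\<rho> n)"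
proof -
  interpret group "Gn n" unfolding Gn_def by (rule group_presented_group)
  have "\<sigma> n \<in> carrier (Gn n)" "\<tau> n \<in> carrier (Gn n)" "\<rho> n \<in> carrier (Gn n)"
    by (auto simp: \<sigma>_def \<tau>_def \<rho>_def Gn_def presented_group_def)
  then show ?thesis
    unfolding Gn_relators_iff_eval[OF \<open>\<sigma> n \<in> carrier (Gn n)\<close> \<open>\<tau> n \<in> carrier (Gn n)\<close> \<open>\<rho> n \<in> carrier (Gn n)\<close>] gens_Gn
    unfolding Gn_def pres_class_eq_eval[symmetric]
    using presented_group_relation by fast
qed

text \<open>Elements of \<open>G\<^sub>n\<close> are shown to be distinct by homomorphisms into explicit groups, which exist
  as soon as the relations are checked there.\<close>

lemma Gn_hom:
  assumes "Gn_relators K n s t r"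
  shows "\<exists>h \<in> hom (Gn n) K. h (\<sigma> n) = s \<and> h (\<tau> n) = t \<and> h (\<rho> n) = r"
proof -
  interpret K: Gn_relators K n s t r by (rule assms)
  have f: "gens s t r x \<in> carrier K" for x by (cases x) auto
  have "gword_eval K (gens s t r) u = gword_eval K (gens s t r) v" if "(u, v) \<in> Gn_relations n" for u v
    using K.Gn_relators_iff_eval[of s t r n] assms that by auto
  then obtain h where h: "h \<in> hom (Gn n) K"
      "\<And>w. h (pres_class (Gn_relations n) w) = gword_eval K (gens s t r) w"
    unfolding Gn_def using presented_group_universal[OF K.is_group, of "gens s t r" "Gn_relations n"] f by auto
  show ?thesis
    by (rule bexI[OF _ h(1)]) (simp add: \<sigma>_def \<tau>_def \<rho>_def h(2) K.gword_eval_letter)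
qed


section \<open>Normal forms\<close>

lemma (in group) int_pow_intertwine:
  assumes [simp]: "x \<in> carrier G" "y \<in> carrier G" "z \<in> carrier G" and xy: "z \<otimes> x = y \<otimes> z"
  shows "z \<otimes> x [^] (i::int) = y [^] i \<otimes> z"
proof -
  have nat: "z \<otimes> x [^] k = y [^] k \<otimes> z" for k :: nat
  proof (induction k)
    case (Suc k)
    have "z \<otimes> x [^] Suc k = (z \<otimes> x [^] k) \<otimes> x" by (simp add: m_assoc)
    also have "\<dots> = y [^] k \<otimes> (z \<otimes> x)" by (simp add: Suc m_assoc)
    also have "\<dots> = y [^] Suc k \<otimes> z" by (simp add: xy m_assoc)
    finally show ?case .
  qed simp
  show ?thesis
  proof (cases i rule: int_cases2)
    case (nonneg k)
    then show ?thesis by (simp add: int_pow_int nat)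
  next
    case (nonpos k)
    have "y [^] k \<otimes> (z \<otimes> inv (x [^] k)) = z"
      by (simp add: m_assoc[symmetric] nat[symmetric]) (simp add: m_assoc)
    then have "z \<otimes> inv (x [^] k) = inv (y [^] k) \<otimes> z"
      by (simp add: inv_solve_left)
    then show ?thesis using nonpos by (simp add: int_pow_neg_int)
  qed
qed

context Gn_relators
begin

text \<open>The exponents are arbitrary integers, so normal forms are not unique; this keeps the multiplication rule free of
  reductions. Only \<open>nf_cong\<close> and \<open>nf_s4\<close> identify different exponents.\<close>

definition nf :: "int \<Rightarrow> int \<Rightarrow> bool \<Rightarrow> 'a" where
  "nf i j c = s [^] i \<otimes> t [^] j \<otimes> (if c then r else \<one>)"

lemma nf_closed [simp]: "nf i j c \<in> carrier G"
  by (simp add: nf_def)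

lemma nf_gens: "s = nf 1 0 False" "t = nf 0 1 False" "r = nf 0 0 True" "\<one> = nf 0 0 False"
  by (simp_all add: nf_def)

lemma nf_add: "nf i j False \<otimes> nf k l c = nf (i + k) (j + l) c"
proof -
  have "t [^] j \<otimes> s = s \<otimes> t [^] j"
    using int_pow_intertwine[of t t s j] ts by simp
  then have comm: "t [^] j \<otimes> s [^] k = s [^] k \<otimes> t [^] j"
    using int_pow_intertwine[of s s "t [^] j" k] by simp
  have "nf i j False \<otimes> nf k l c
      = s [^] i \<otimes> (t [^] j \<otimes> s [^] k) \<otimes> t [^] l \<otimes> (if c then r else \<one>)"
    by (simp add: nf_def m_assoc)
  also have "\<dots> = (s [^] i \<otimes> s [^] k) \<otimes> (t [^] j \<otimes> t [^] l) \<otimes> (if c then r else \<one>)"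
    unfolding comm by (simp add: m_assoc)
  finally show ?thesis by (simp add: nf_def int_pow_mult)
qed

lemma nf_power: "nf i j False [^] (k::int) = nf (k * i) (k * j) False"
proof -
  have nat: "nf i j False [^] m = nf (int m * i) (int m * j) False" for m :: nat
  proof (induction m)
    case 0
    show ?case by (simp add: nf_gens(4)[symmetric])
  next
    case (Suc m)
    then show ?case by (simp add: nf_add algebra_simps)
  qed
  have neg: "inv (nf i j False) = nf (- i) (- j) False" for i j
    by (rule inv_equality) (simp_all add: nf_add nf_gens(4)[symmetric])
  show ?thesis
    by (cases k rule: int_cases2) (simp_all add: int_pow_int int_pow_neg_int nat neg)
qed

lemma nf_cong: "8 dvd i - i' \<Longrightarrow> nf i j c = nf i' j c"
proof -
  assume "8 dvd i - i'"
  then obtain k where k: "i = i' + 8 * k" by (metis dvd_def diff_eq_eq add.commute)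
  have "s [^] (8 * k) = (s [^] (8::int)) [^] k" by (simp add: int_pow_pow)
  also have "s [^] (8::int) = s [^] (8::nat)" using int_pow_int[of G s 8] by simp
  finally have "s [^] (8 * k) = \<one>" by (simp add: s8)
  then show ?thesis unfolding k by (simp add: nf_def int_pow_mult)
qed

lemma r_nf: "r \<otimes> nf i j False = nf (3 * i) (- j) True"
proof -
  have "s [^] (3::int) = s [^] (3::nat)" "s [^] (8::int) = s [^] (8::nat)"
    using int_pow_int[of G s 3] int_pow_int[of G s 8] by simp_all
  then have sr': "s \<otimes> r = r \<otimes> s [^] (3::int)" using sr by simp
  have "s [^] (3::int) \<otimes> r = r \<otimes> s"
  proof -
    have "r \<otimes> (s [^] (3::int)) [^] (3::int) = s [^] (3::int) \<otimes> r"
      by (rule int_pow_intertwine) (simp_all add: sr')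
    moreover have "(s [^] (3::int)) [^] (3::int) = s"
      using nf_cong[of 9 1 0 False] by (simp add: int_pow_pow nf_def)
    ultimately show ?thesis by simp
  qed
  then have 1: "r \<otimes> s [^] i = (s [^] (3::int)) [^] i \<otimes> r"
    by (intro int_pow_intertwine) simp_all
  have "r \<otimes> t = inv t \<otimes> r"
    using trt by (simp add: inv_solve_left m_assoc)
  then have 2: "r \<otimes> t [^] j = (inv t) [^] j \<otimes> r"
    by (intro int_pow_intertwine) simp_all
  have "r \<otimes> nf i j False = (r \<otimes> s [^] i) \<otimes> t [^] j" by (simp add: nf_def m_assoc)
  also have "\<dots> = (s [^] (3::int)) [^] i \<otimes> (r \<otimes> t [^] j)" by (simp add: 1 m_assoc)
  also have "\<dots> = (s [^] (3::int)) [^] i \<otimes> (inv t) [^] j \<otimes> r" by (simp add: 2 m_assoc)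
  finally show ?thesis by (simp add: nf_def int_pow_pow int_pow_inv int_pow_neg)
qed

lemma r_sq: "r \<otimes> r = nf 2 (2 ^ n) False"
proof -
  have "t [^] (2 ^ n :: int) = t [^] (2 ^ n :: nat)" "s [^] (2::int) = s [^] (2::nat)"
    using int_pow_int[of G t "2 ^ n"] int_pow_int[of G s 2] by simp_all
  then have "r \<otimes> r = nf 0 (2 ^ n) False \<otimes> nf 2 0 False"
    using r2 by (simp add: nf_def numeral_2_eq_2)
  then show ?thesis by (simp add: nf_add)
qed

lemma nf_mult:
  "nf i j c \<otimes> nf k l d =
    (if c then nf (i + 3 * k + (if d then 2 else 0)) (j - l + (if d then 2 ^ n else 0)) (\<not> d)
     else nf (i + k) (j + l) d)"
proof -
  have split: "nf i j True = nf i j False \<otimes> r" for i j by (simp add: nf_def)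
  have T: "nf i j True \<otimes> nf k l False = nf (i + 3 * k) (j - l) True"
    by (simp add: split[of i] m_assoc r_nf nf_add)
  have "nf i j True \<otimes> nf k l True = nf i j True \<otimes> nf k l False \<otimes> r"
    by (simp add: split[of k] m_assoc)
  also have "\<dots> = nf (i + 3 * k) (j - l) False \<otimes> (r \<otimes> r)" 
    by (simp add: T split[of "i + 3 * k"] m_assoc)
  finally show ?thesis using T by (auto simp: nf_add r_sq)
qed

lemma nf_inv:
  "inv (nf i j c) = (if c then nf (- 3 * i - 6) (j + 2 ^ n) True else nf (- i) (- j) False)"
proof (rule inv_equality[OF inv_comm])
  show "nf i j c \<otimes> (if c then nf (- 3 * i - 6) (j + 2 ^ n) True else nf (- i) (- j) False) = \<one>"
    using nf_cong[of "- 16 - 8 * i" 0 0 False] by (auto simp: nf_mult nf_gens(4))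
qed auto

lemma nf_s4: "nf 4 (- (2 ^ (n + 1))) False = \<one>"
proof -
  have "t [^] (2 ^ (n + 1) :: int) = t [^] (2 ^ (n + 1) :: nat)" "s [^] (4::int) = s [^] (4::nat)"
    using int_pow_int[of G t "2 ^ (n + 1)"] int_pow_int[of G s 4] by simp_all
  then show ?thesis using s4 by (simp add: nf_def int_pow_neg)
qed

text \<open>As this subgroup contains the generators, it is all of \<open>G\<^sub>n\<close> (see \<open>nf_surj\<close>).\<close>

lemma nf_subgroup: "subgroup {nf i j c | i j c. True} G"
proof (rule subgroupI)
  fix x assume "x \<in> {nf i j c | i j c. True}"
  then show "inv x \<in> {nf i j c | i j c. True}" by (auto simp only: nf_inv split: if_splits) blast+
next
  fix x y assume "x \<in> {nf i j c | i j c. True}" "y \<in> {nf i j c | i j c. True}"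
  then show "x \<otimes> y \<in> {nf i j c | i j c. True}" by (auto simp only: nf_mult split: if_splits) blast+
qed auto

lemma commutator_nf:
  "nf a b True \<otimes> nf i j False \<otimes> inv (nf a b True) \<otimes> inv (nf i j False) = nf (2 * i) (- 2 * j) False"
  by (simp add: nf_inv nf_mult) (rule nf_cong, presburger)

text \<open>The source of all elements of derived subgroups below. The sign of the second exponent reflects that
  \<open>r\<close> inverts \<open>t\<close> but cubes \<open>s\<close>.\<close>

lemma nf_derived:
  assumes "nf a b True \<in> H" "nf i j False \<in> H"
  shows "nf (2 * i) (- 2 * j) False \<in> derived G H"
  unfolding commutator_nf[of a b, symmetric] derived_def
  by (rule generate.incl) (use assms in blast)

end

lemma (in group) gword_eval_subgroup:
  assumes "subgroup H G" "\<And>x. f x \<in> H"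
  shows "gword_eval G f w \<in> H"
  by (induction w)
    (auto simp: gword_eval_def assms subgroup.one_closed subgroup.m_closed subgroup.m_inv_closed)

lemma nf_surj:
  assumes "x \<in> carrier (Gn n)"
  shows "\<exists>i j c. x = Gn_relators.nf (Gn n) (\<sigma> n) (\<tau> n) (\<rho> n) i j c"
proof -
  interpret Gn_relators "Gn n" n "\<sigma> n" "\<tau> n" "\<rho> n" by (rule Gn_relators_Gn)
  obtain w where "x = pres_class (Gn_relations n) w" using assms by (auto simp: Gn_def presented_group_def)
  then have "x = gword_eval (Gn n) (gens (\<sigma> n) (\<tau> n) (\<rho> n)) w"
    by (simp only: gens_Gn Gn_def pres_class_eq_eval[symmetric])
  moreover have "gens (\<sigma> n) (\<tau> n) (\<rho> n) y \<in> {nf i j c | i j c. True}" for y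
    using nf_gens(1-3) by (cases y; simp only: gens.simps; blast)
  ultimately have "x \<in> {nf i j c | i j c. True}"
    by (simp only: gword_eval_subgroup[OF nf_subgroup])
  then show ?thesis by blast
qed


section \<open>Parities of exponents\<close>

type_synonym bit3 = "bool \<times> bool \<times> bool"

fun xor3 :: "bit3 \<Rightarrow> bit3 \<Rightarrow> bit3" where
  "xor3 (a, b, c) (a', b', c') = (a \<noteq> a', b \<noteq> b', c \<noteq> c')"

definition parity_group :: "bit3 monoid" where
  "parity_group = \<lparr>carrier = UNIV, monoid.mult = xor3, one = (False, False, False)\<rparr>"

lemma parity_group_simps [simp]:
  "carrier parity_group = UNIV" "x \<otimes>\<^bsub>parity_group\<^esub> y = xor3 x y"
  "\<one>\<^bsub>parity_group\<^esub> = (False, False, False)"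
  by (simp_all add: parity_group_def)

lemma xor3_self: "xor3 e e = (False, False, False)"
  by (cases e) auto

lemma comm_group_parity: "comm_group parity_group"
proof (rule comm_groupI)
  fix x assume "x \<in> carrier parity_group"
  then show "\<exists>y\<in>carrier parity_group. y \<otimes>\<^bsub>parity_group\<^esub> x = \<one>\<^bsub>parity_group\<^esub>"
    by (intro bexI[of _ x]) (auto simp: xor3_self)
qed (auto simp: split_paired_all)

interpretation parity: comm_group parity_group by (rule comm_group_parity)

lemma parity_nat_pow: "e [^]\<^bsub>parity_group\<^esub> (k::nat) = (if even k then (False, False, False) else e)"
  by (induction k) (cases e; auto)+

lemma parity_inv: "inv\<^bsub>parity_group\<^esub> e = e"
  by (rule parity.inv_equality) (auto simp: xor3_self)

lemma parity_int_pow: "e [^]\<^bsub>parity_group\<^esub> (k::int) = (if even k then (False, False, False) else e)"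
  by (cases k rule: int_cases2)
    (simp_all add: int_pow_int parity.int_pow_neg_int parity_nat_pow parity_inv)

text \<open>Every relation holds modulo squares because both sides have the same exponent parities; this uses that
  \<open>2^n\<close> is even.\<close>

lemma parity_hom:
  assumes "n \<ge> 1"
  shows "\<exists>h \<in> hom (Gn n) parity_group. h (\<sigma> n) = (True, False, False) \<and>
     h (\<tau> n) = (False, True, False) \<and> h (\<rho> n) = (False, False, True)"
  using assms by (intro Gn_hom) (unfold_locales, auto simp: parity_nat_pow)

text \<open>Used as a rewrite rule, this computes the span of any explicit finite set of parity vectors.\<close>

lemma parity_generate_insert:
  "generate parity_group (insert e S) = generate parity_group S \<union> xor3 e ` generate parity_group S"
proof (intro equalityI subsetI)
  fix x assume "x \<in> generate parity_group (insert e S)"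
  then show "x \<in> generate parity_group S \<union> xor3 e ` generate parity_group S"
  proof (induction rule: generate.induct)
    case (incl h)
    then show ?case using generate.one[of parity_group S] generate.incl[of h S parity_group] 
      by (cases e) (auto intro!: image_eqI[where x="(False, False, False)"])
  next
    case (inv h)
    then show ?case using generate.one[of parity_group S] generate.incl[of h S parity_group] 
      by (cases e) (auto simp: parity_inv intro!: image_eqI[where x="(False, False, False)"])
  next
    case (eng x y)
    obtain x' y' where x': "x' \<in> generate parity_group S" "x = x' \<or> x = xor3 e x'"
      and y': "y' \<in> generate parity_group S" "y = y' \<or> y = xor3 e y'"
      using eng.IH by blast
    have "xor3 x y = xor3 x' y' \<or> xor3 x y = xor3 e (xor3 x' y')"
      using x'(2) y'(2) by (cases e; cases x'; cases y'; auto)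
    moreover have "xor3 x' y' \<in> generate parity_group S"
      using generate.eng[OF x'(1) y'(1)] by simp
    ultimately show ?case by auto
  qed (auto intro: generate.one[of parity_group S, simplified])
next
  fix x assume "x \<in> generate parity_group S \<union> xor3 e ` generate parity_group S"
  moreover have "generate parity_group S \<subseteq> generate parity_group (insert e S)"
    by (rule parity.mono_generate) auto
  moreover have "xor3 e y \<in> generate parity_group (insert e S)" if "y \<in> generate parity_group (insert e S)" for y
    using generate.eng[OF generate.incl[of e "insert e S"] that] by simp
  ultimately show "x \<in> generate parity_group (insert e S)" by auto
qed

lemma parity_generate_empty: "generate parity_group {} = {(False, False, False)}"
  using parity.generate_empty by simp


section \<open>Monomial representations\<close>

text \<open>The wreath product of \<open>\<int>/N\<close> with \<open>\<int>/2\<close>: a triple \<open>(a, b, c)\<close>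
  stands for the diagonal matrix with entries \<open>\<zeta>\<^sup>a, \<zeta>\<^sup>b\<close>, times the swap
  matrix if \<open>c\<close>, where \<open>\<zeta>\<close> is a primitive \<open>N\<close>-th root of unity.\<close>

definition wreath :: "int \<Rightarrow> (int \<times> int \<times> bool) monoid" where
  "wreath N = \<lparr>carrier = {0..<N} \<times> {0..<N} \<times> UNIV,
     monoid.mult = (\<lambda>(a, b, c) (a', b', c').
       ((a + (if c then b' else a')) mod N, (b + (if c then a' else b')) mod N, c \<noteq> c')),
     one = (0, 0, False)\<rparr>"

lemma wreath_simps [simp]:
  "carrier (wreath N) = {0..<N} \<times> {0..<N} \<times> UNIV"
  "(a, b, c) \<otimes>\<^bsub>wreath N\<^esub> (a', b', c') =
     ((a + (if c then b' else a')) mod N, (b + (if c then a' else b')) mod N, c \<noteq> c')"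
  "\<one>\<^bsub>wreath N\<^esub> = (0, 0, False)"
  by (simp_all add: wreath_def)

lemma group_wreath:
  assumes "N > 0" shows "group (wreath N)"
proof (rule groupI)
  fix x assume "x \<in> carrier (wreath N)"
  moreover obtain a b c where "x = (a, b, c)" by (cases x)
  ultimately show "\<exists>y\<in>carrier (wreath N). y \<otimes>\<^bsub>wreath N\<^esub> x = \<one>\<^bsub>wreath N\<^esub>"
    using assms
    by (intro bexI[of _ "if c then ((- b) mod N, (- a) mod N, True) else ((- a) mod N, (- b) mod N, False)"])
      (auto simp: mod_simps)
next
  fix x y z :: "int \<times> int \<times> bool"
  obtain a b c a' b' c' a'' b'' c'' where "x = (a, b, c)" "y = (a', b', c')" "z = (a'', b'', c'')"
    by (cases x; cases y; cases z)
  then show "x \<otimes>\<^bsub>wreath N\<^esub> y \<otimes>\<^bsub>wreath N\<^esub> z = x \<otimes>\<^bsub>wreath N\<^esub> (y \<otimes>\<^bsub>wreath N\<^esub> z)"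
    by (cases c; cases c'; cases c'') (simp_all add: mod_simps add.assoc)
qed (use assms in auto)

lemma wreath_nat_pow:
  assumes "N > 0"
  shows "(a mod N, b mod N, False) [^]\<^bsub>wreath N\<^esub> (k::nat) = (int k * a mod N, int k * b mod N, False)"
proof -
  interpret group "wreath N" by (rule group_wreath[OF assms])
  show ?thesis by (induction k) (simp_all add: mod_simps algebra_simps)
qed

lemma wreath_int_pow:
  assumes "N > 0"
  shows "(a mod N, b mod N, False) [^]\<^bsub>wreath N\<^esub> (k::int) = (k * a mod N, k * b mod N, False)"
proof -
  interpret group "wreath N" by (rule group_wreath[OF assms])
  have "inv\<^bsub>wreath N\<^esub> (a mod N, b mod N, False) = ((- a) mod N, (- b) mod N, False)" for a b
    using assms by (intro inv_equality) (auto simp: mod_simps)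
  then show ?thesis
    using assms by (cases k rule: int_cases2) (auto simp: int_pow_int int_pow_neg_int wreath_nat_pow)
qed

text \<open>The element \<open>s\<close> must be cubed and \<open>t\<close> inverted by swapping coordinates, which suggests
  \<open>(p, 3p)\<close> and \<open>(u, -u)\<close>, where \<open>8p = 0\<close> makes the cube of \<open>(p,
  3p)\<close> its swap. The square of \<open>(x, 0)\<close> times the swap is \<open>(x, x)\<close>, so
  \<open>x\<close> is determined by the relation for \<open>r\<^sup>2\<close>; all other relations follow from
  the three congruences.\<close>

lemma wreath_relators:
  assumes N: "N > 0" and p: "8 * p mod N = 0" and pu: "4 * p mod N = 2 ^ (n + 1) * u mod N"
    and x: "x mod N = (2 ^ n * u + 2 * p) mod N"
  shows "Gn_relators (wreath N) n (p mod N, 3 * p mod N, False) (u mod N, - u mod N, False) (x mod N, 0, True)"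
proof -
  interpret group "wreath N" by (rule group_wreath[OF N])
  have N': "0 \<le> y mod N" "y mod N < N" for y using N by auto
  have d: "N dvd 8 * p" "N dvd 4 * p - 2 ^ (n + 1) * u" "N dvd x - (2 ^ n * u + 2 * p)"
    using p pu x by (simp_all only: mod_eq_dvd_iff mod_eq_0_iff_dvd)
  have xx: "(x + x) mod N = 0"
  proof -
    have "N dvd 2 * (x - (2 ^ n * u + 2 * p)) - (4 * p - 2 ^ (n + 1) * u) + 8 * p"
      by (rule dvd_add[OF dvd_diff[OF dvd_mult[OF d(3)] d(2)] d(1)])
    also have "2 * (x - (2 ^ n * u + 2 * p)) - (4 * p - 2 ^ (n + 1) * u) + 8 * p = x + x"
      by (simp add: algebra_simps)
    finally show ?thesis by (simp only: mod_eq_0_iff_dvd)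
  qed
  have x': "x mod N = (2 ^ n * (- u) + 2 * (3 * p)) mod N"
  proof -
    have "N dvd (x - (2 ^ n * u + 2 * p)) - (4 * p - 2 ^ (n + 1) * u)"
      by (rule dvd_diff[OF d(3,2)])
    also have "(x - (2 ^ n * u + 2 * p)) - (4 * p - 2 ^ (n + 1) * u) = x - (2 ^ n * (- u) + 2 * (3 * p))"
      by (simp add: algebra_simps)
    finally show ?thesis by (simp only: mod_eq_dvd_iff)
  qed
  have u0: "2 ^ (n + 2) * u mod N = 0" "2 ^ (n + 2) * (- u) mod N = 0"
  proof -
    have "N dvd 8 * p - 2 * (4 * p - 2 ^ (n + 1) * u)" by (rule dvd_diff[OF d(1) dvd_mult[OF d(2)]])
    also have "8 * p - 2 * (4 * p - 2 ^ (n + 1) * u) = 2 ^ (n + 2) * u" by (simp add: algebra_simps)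
    finally show "2 ^ (n + 2) * u mod N = 0" "2 ^ (n + 2) * (- u) mod N = 0"
      by (simp_all only: mod_eq_0_iff_dvd mult_minus_right dvd_minus_iff)
  qed
  have pu': "4 * (3 * p) mod N = 2 ^ (n + 1) * (- u) mod N"
  proof -
    have "N dvd 2 * (8 * p) - (4 * p - 2 ^ (n + 1) * u)" by (rule dvd_diff[OF dvd_mult[OF d(1)] d(2)])
    also have "2 * (8 * p) - (4 * p - 2 ^ (n + 1) * u) = 4 * (3 * p) - 2 ^ (n + 1) * (- u)"
      by (simp add: algebra_simps)
    finally show ?thesis by (simp only: mod_eq_dvd_iff)
  qed
  have p8: "8 * (3 * p) mod N = 0"
    using dvd_mult[OF d(1), of 3] by (simp only: mod_eq_0_iff_dvd mult.left_commute)
  have p9: "(p + x) mod N = (x + 3 * (3 * p)) mod N"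
    using d(1) by (simp add: mod_eq_dvd_iff)
  have pow2: "y [^]\<^bsub>wreath N\<^esub> (2::nat) = \<one>\<^bsub>wreath N\<^esub> \<otimes>\<^bsub>wreath N\<^esub> y \<otimes>\<^bsub>wreath N\<^esub> y" for y
    by (simp add: numeral_2_eq_2)
  have r2: "(x mod N, 0, True) [^]\<^bsub>wreath N\<^esub> (2::nat) = (x mod N, x mod N, False)"
    by (simp add: pow2)
  have four: "(x mod N, 0, True) [^]\<^bsub>wreath N\<^esub> (4::nat)
     = ((x mod N, 0, True) [^]\<^bsub>wreath N\<^esub> (2::nat)) [^]\<^bsub>wreath N\<^esub> (2::nat)"
    using nat_pow_pow[of "(x mod N, 0, True)" 2 2] N' N by simp
  show ?thesis
  proof unfold_locales
    show "(x mod N, 0, True) [^]\<^bsub>wreath N\<^esub> (4::nat) = \<one>\<^bsub>wreath N\<^esub>"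
      unfolding four r2 pow2 using xx by (simp add: mod_simps)
    show "(x mod N, 0, True) [^]\<^bsub>wreath N\<^esub> (2::nat) =
        (u mod N, - u mod N, False) [^]\<^bsub>wreath N\<^esub> (2 ^ n :: nat) \<otimes>\<^bsub>wreath N\<^esub>
        (p mod N, 3 * p mod N, False) [^]\<^bsub>wreath N\<^esub> (2::nat)"
      unfolding r2 wreath_nat_pow[OF N] using x x' by (simp add: mod_simps)
    show "(u mod N, - u mod N, False) [^]\<^bsub>wreath N\<^esub> (2 ^ (n + 2) :: nat) = \<one>\<^bsub>wreath N\<^esub>"
      unfolding wreath_nat_pow[OF N] using u0 by simp
    show "(p mod N, 3 * p mod N, False) [^]\<^bsub>wreath N\<^esub> (4::nat) =
       (u mod N, - u mod N, False) [^]\<^bsub>wreath N\<^esub> (2 ^ (n + 1) :: nat)"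
      unfolding wreath_nat_pow[OF N] using pu pu' by simp
    show "(p mod N, 3 * p mod N, False) [^]\<^bsub>wreath N\<^esub> (8::nat) = \<one>\<^bsub>wreath N\<^esub>"
      unfolding wreath_nat_pow[OF N] using p p8 by simp
    show "(p mod N, 3 * p mod N, False) \<otimes>\<^bsub>wreath N\<^esub> (x mod N, 0, True) =
       (x mod N, 0, True) \<otimes>\<^bsub>wreath N\<^esub> (p mod N, 3 * p mod N, False) [^]\<^bsub>wreath N\<^esub> (3::nat)"
      unfolding wreath_nat_pow[OF N] using p9 by (simp add: mod_simps)
    show "(u mod N, - u mod N, False) \<otimes>\<^bsub>wreath N\<^esub> (p mod N, 3 * p mod N, False) =
      (p mod N, 3 * p mod N, False) \<otimes>\<^bsub>wreath N\<^esub> (u mod N, - u mod N, False)"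
      by (simp add: add.commute)
    show "(u mod N, - u mod N, False) \<otimes>\<^bsub>wreath N\<^esub> (x mod N, 0, True) \<otimes>\<^bsub>wreath N\<^esub> 
      (u mod N, - u mod N, False) = (x mod N, 0, True)"
      by (simp add: mod_simps)
  qed (use N' N in auto)
qed


section \<open>Derived subgroups\<close>

text \<open>The upper bounds for derived subgroups: if the image of a subgroup is abelian, its derived subgroup lies in the
  kernel.\<close>

lemma (in group_hom) hom_derived_trivial:
  assumes H: "H' \<subseteq> carrier G" and comm: "\<And>x y. x \<in> H' \<Longrightarrow> y \<in> H' \<Longrightarrow> h x \<otimes>\<^bsub>H\<^esub> h y = h y \<otimes>\<^bsub>H\<^esub> h x"
    and d: "d \<in> derived G H'"
  shows "h d = \<one>\<^bsub>H\<^esub>"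
proof -
  have "derived_set G H' \<subseteq> kernel G H h"
  proof
    fix z assume "z \<in> derived_set G H'"
    then obtain x y where xy: "x \<in> H'" "y \<in> H'" "z = x \<otimes> y \<otimes> inv x \<otimes> inv y" by blast
    have c: "x \<in> carrier G" "y \<in> carrier G" using xy H by auto
    have "h z = h y \<otimes>\<^bsub>H\<^esub> h x \<otimes>\<^bsub>H\<^esub> inv\<^bsub>H\<^esub> h x \<otimes>\<^bsub>H\<^esub> inv\<^bsub>H\<^esub> h y"
      using c comm[OF xy(1,2)] unfolding xy(3) by simp
    then show "z \<in> kernel G H h" using c xy(3) by (simp add: kernel_def H.m_assoc)
  qed
  then have "derived G H' \<subseteq> kernel G H h"
    unfolding derived_def by (rule G.generate_subgroup_incl[OF _ subgroup_kernel])
  then show ?thesis using d by (auto simp: kernel_def)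
qed

lemma (in group) subgroup_centralizer:
  assumes "A \<subseteq> carrier G" shows "subgroup {x \<in> carrier G. \<forall>a\<in>A. x \<otimes> a = a \<otimes> x} G"
proof (rule subgroupI)
  fix x assume x: "x \<in> {x \<in> carrier G. \<forall>a\<in>A. x \<otimes> a = a \<otimes> x}"
  have "inv x \<otimes> a = a \<otimes> inv x" if a: "a \<in> A" for a
  proof -
    have c: "x \<in> carrier G" "a \<in> carrier G" "x \<otimes> a = a \<otimes> x" using x a assms by auto
    have "x \<otimes> (a \<otimes> inv x) = (x \<otimes> a) \<otimes> inv x" using c(1,2) by (simp add: m_assoc)
    also have "\<dots> = a" unfolding c(3) using c(1,2) by (simp add: m_assoc)
    finally show ?thesis using c(1,2) by (simp add: inv_solve_left')
  qed
  then show "inv x \<in> {x \<in> carrier G. \<forall>a\<in>A. x \<otimes> a = a \<otimes> x}" using x by auto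
next
  fix x y assume xy: "x \<in> {x \<in> carrier G. \<forall>a\<in>A. x \<otimes> a = a \<otimes> x}" "y \<in> {x \<in> carrier G. \<forall>a\<in>A. x \<otimes> a = a \<otimes> x}"
  have "x \<otimes> y \<otimes> a = a \<otimes> (x \<otimes> y)" if a: "a \<in> A" for a
  proof -
    have c: "x \<in> carrier G" "y \<in> carrier G" "a \<in> carrier G" using xy a assms by auto
    have xa: "x \<otimes> a = a \<otimes> x" and ya: "y \<otimes> a = a \<otimes> y" using xy a by auto
    have "x \<otimes> y \<otimes> a = (x \<otimes> a) \<otimes> y" using c by (simp add: m_assoc ya)
    also have "\<dots> = a \<otimes> (x \<otimes> y)" unfolding xa using c by (simp add: m_assoc)
    finally show ?thesis .
  qed
  then show "x \<otimes> y \<in> {x \<in> carrier G. \<forall>a\<in>A. x \<otimes> a = a \<otimes> x}" using xy by auto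
qed (use assms in \<open>auto intro!: exI[of _ \<one>]\<close>)

lemma (in group) generate_commute:
  assumes S: "S \<subseteq> carrier G" and comm: "\<And>x y. x \<in> S \<Longrightarrow> y \<in> S \<Longrightarrow> x \<otimes> y = y \<otimes> x"
    and "x \<in> generate G S" "y \<in> generate G S"
  shows "x \<otimes> y = y \<otimes> x"
proof -
  have "S \<subseteq> {x \<in> carrier G. \<forall>a\<in>S. x \<otimes> a = a \<otimes> x}" using S comm by auto
  then have 1: "generate G S \<subseteq> {x \<in> carrier G. \<forall>a\<in>S. x \<otimes> a = a \<otimes> x}"
    by (rule generate_subgroup_incl[OF _ subgroup_centralizer[OF S]])
  have "S \<subseteq> {x \<in> carrier G. \<forall>a\<in>generate G S. x \<otimes> a = a \<otimes> x}" using S 1 by auto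
  then have "generate G S \<subseteq> {x \<in> carrier G. \<forall>a\<in>generate G S. x \<otimes> a = a \<otimes> x}"
    by (rule generate_subgroup_incl[OF _ subgroup_centralizer[OF generate_incl[OF S]]])
  then show ?thesis using assms(3,4) by auto
qed

lemma (in group_hom) hom_derived_generate_trivial:
  assumes S: "S \<subseteq> carrier G" and comm: "\<And>x y. x \<in> S \<Longrightarrow> y \<in> S \<Longrightarrow> h x \<otimes>\<^bsub>H\<^esub> h y = h y \<otimes>\<^bsub>H\<^esub> h x"
    and d: "d \<in> derived G (generate G S)"
  shows "h d = \<one>\<^bsub>H\<^esub>"
proof (rule hom_derived_trivial[OF _ _ d])
  show "generate G S \<subseteq> carrier G" by (rule G.generate_incl[OF S])
  fix x y assume "x \<in> generate G S" "y \<in> generate G S"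
  then have "h x \<in> generate H (h ` S)" "h y \<in> generate H (h ` S)" unfolding generate_img[OF S] by auto
  then show "h x \<otimes>\<^bsub>H\<^esub> h y = h y \<otimes>\<^bsub>H\<^esub> h x"
    by (rule H.generate_commute[rotated 2]) (use S comm in auto)
qed


section \<open>The group \<open>G\<^sub>n\<close>\<close>

text \<open>Names for \<open>G\<^sub>n\<close> and its generators that allow the infix notation for the group operation.\<close>

locale G_n =
  fixes n :: nat and G (structure) and s t r
  assumes n: "n \<ge> 1" and G: "G = Gn n" and s_def: "s = \<sigma> n" and t_def: "t = \<tau> n" and r_def: "r = \<rho> n"
begin

sublocale Gn_relators G n s t r
  unfolding G s_def t_def r_def by (rule Gn_relators_Gn)

text \<open>The abelianization map of \<open>G\<^sub>n\<close>, in coordinates; that its kernel is \<open>G\<^sub>n'\<close>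
  is \<open>derived_G\<close>.\<close>

definition par :: "gen gword set \<Rightarrow> bit3" where
  "par = (SOME h. h \<in> hom G parity_group \<and> h s = (True, False, False) \<and>
      h t = (False, True, False) \<and> h r = (False, False, True))"

lemma par: "par \<in> hom G parity_group" "par s = (True, False, False)"
    "par t = (False, True, False)" "par r = (False, False, True)"
proof -
  have "\<exists>h. h \<in> hom G parity_group \<and> h s = (True, False, False) \<and>
      h t = (False, True, False) \<and> h r = (False, False, True)"
    unfolding G s_def t_def r_def using parity_hom[OF n] by blast
  from someI_ex[OF this] show "par \<in> hom G parity_group" "par s = (True, False, False)"
    "par t = (False, True, False)" "par r = (False, False, True)"
    unfolding par_def by blast+
qed

sublocale exp2_hom G parity_group par
proof (intro exp2_hom.intro exp2_hom_axioms.intro)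
  show "group G" by (rule is_group)
  show "comm_group parity_group" by (rule comm_group_parity)
qed (auto simp: par(1) xor3_self)

lemma par_nf [simp]: "par (nf i j c) = (odd i, odd j, c)"
  by (auto simp: nf_def hom_int_pow par parity_int_pow)

lemma nf_exhaust:
  assumes "g \<in> carrier G" obtains i j c where "g = nf i j c"
  using nf_surj[of g n] assms unfolding G s_def[symmetric] t_def[symmetric] r_def[symmetric] by blast

lemma nf_in_preim [simp]: "nf i j c \<in> preim U \<longleftrightarrow> (odd i, odd j, c) \<in> U"
  by (simp add: preim_def)

lemma conj_nf:
  "inv (nf k l d) \<otimes> nf a b False \<otimes> nf k l d = (if d then nf (3 * a) (- b) False else nf a b False)"
proof (cases d)
  case True
  have "nf k l True \<otimes> nf (3 * a) (- b) False = nf a b False \<otimes> nf k l True"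
    using nf_cong[of "k + 9 * a" "k + a"] by (simp add: nf_mult add.commute)
  then have "nf (3 * a) (- b) False = inv (nf k l True) \<otimes> (nf a b False \<otimes> nf k l True)"
    by (intro inv_solve_left[THEN iffD2]) auto
  then show ?thesis using True by (simp add: m_assoc)
qed (simp add: nf_mult nf_inv)

lemma derived_G: "derived G (carrier G) = preim {\<one>\<^bsub>parity_group\<^esub>}"
proof (intro equalityI subsetI)
  fix x assume x: "x \<in> derived G (carrier G)"
  then have "par x = \<one>\<^bsub>parity_group\<^esub>"
    by (rule hom_derived_trivial[OF subset_refl, rotated]) (rule parity.m_comm, auto)
  then show "x \<in> preim {\<one>\<^bsub>parity_group\<^esub>}"
    using x derived_in_carrier[OF subset_refl] by (auto simp: preim_def)
next
  fix x assume x: "x \<in> preim {\<one>\<^bsub>parity_group\<^esub>}"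
  then obtain i j c where "x = nf i j c" by (auto simp: preim_def elim: nf_exhaust)
  then have "x = nf i j False" "even i" "even j" using x by auto
  then have "x = nf (2 * (i div 2)) (- 2 * (- (j div 2))) False" by simp
  then show "x \<in> derived G (carrier G)"
    using nf_derived[of 0 0 "carrier G" "i div 2" "- (j div 2)"] by simp
qed

lemma wreath_hom:
  assumes "N > 0" "8 * p mod N = 0" "4 * p mod N = 2 ^ (n + 1) * u mod N"
    "x mod N = (2 ^ n * u + 2 * p) mod N"
  shows "\<exists>\<phi>. group_hom G (wreath N) \<phi> \<and>
    (\<forall>i j. \<phi> (nf i j False) = ((i * p + j * u) mod N, (i * (3 * p) - j * u) mod N, False)) \<and>
    (\<forall>i j. snd (snd (\<phi> (nf i j True))))"
proof -
  obtain \<phi> where \<phi>: "\<phi> \<in> hom G (wreath N)" "\<phi> s = (p mod N, 3 * p mod N, False)"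
      "\<phi> t = (u mod N, - u mod N, False)" "\<phi> r = (x mod N, 0, True)"
    using Gn_hom[OF wreath_relators[OF assms]] unfolding G s_def t_def r_def by blast
  interpret \<phi>: group_hom G "wreath N" \<phi>
    using \<phi>(1) group_wreath[OF assms(1)] is_group by (simp add: group_hom_def group_hom_axioms_def)
  have F: "\<phi> (nf i j False) = ((i * p + j * u) mod N, (i * (3 * p) - j * u) mod N, False)" for i j
  proof -
    have "\<phi> (nf i j False) = \<phi> s [^]\<^bsub>wreath N\<^esub> i \<otimes>\<^bsub>wreath N\<^esub> \<phi> t [^]\<^bsub>wreath N\<^esub> j"
      by (simp add: nf_def \<phi>.hom_int_pow)
    then show ?thesis unfolding \<phi>(2,3) wreath_int_pow[OF assms(1)] by (simp add: mod_simps)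
  qed
  have "nf i j True = nf i j False \<otimes> r" for i j by (simp add: nf_def)
  then have "\<phi> (nf i j True) = \<phi> (nf i j False) \<otimes>\<^bsub>wreath N\<^esub> \<phi> r" for i j by simp
  then show ?thesis using F \<phi>(4) \<phi>.group_hom_axioms by auto
qed

text \<open>The exponent pairs of the elements of \<open>K \<inter> \<langle>s, t\<rangle>\<close> form a lattice, so
  memberships can be found by integer combinations.\<close>

lemma nf_lattice:
  assumes "subgroup K G" "nf i j False \<in> K" "nf k l False \<in> K"
  shows "nf (x * i + y * k) (x * j + y * l) False \<in> K"
proof -
  have "nf i j False [^] x \<otimes> nf k l False [^] y \<in> K"
    using assms by (intro subgroup.m_closed subgroup_int_pow_closed)
  then show ?thesis by (simp add: nf_power nf_mult)
qed

text \<open>Half the exponent of \<open>t\<close> in \<open>r\<^sup>2\<close>; its parity separates \<open>n = 1\<close>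
  from \<open>n \<ge> 2\<close>.\<close>

definition m where "m = (2 ^ (n - 1) :: int)"

lemma pow_n: "(2 ^ n :: int) = 2 * m"
  using n by (simp add: m_def power_Suc[symmetric] del: power_Suc)

lemma even_m: "even m \<longleftrightarrow> n \<noteq> 1"
  using n by (auto simp: m_def)

lemma derived_subgroup:
  assumes "subgroup U parity_group" shows "subgroup (derived G (preim U)) G"
  by (rule derived_is_subgroup) (auto simp: preim_def)

text \<open>The quotient used here has \<open>t \<mapsto> 1\<close>; it is the quaternion group of order 8 generated by
  \<open>s, r\<close>. The listed generators of \<open>H\<close> have commuting images, since \<open>t\<close>
  disappears, while \<open>s\<^sup>2\<close> survives.\<close>

lemma derived_iff_even_s:
  assumes U: "subgroup U parity_group" and S: "S \<subseteq> {nf a b True, nf 0 1 False}" "generate G S = preim U"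
    and H: "(odd a, odd b, True) \<in> U" "(False, True, False) \<in> U"
  shows "nf (2 * i) (2 * j) False \<in> derived G (preim U) \<longleftrightarrow> even i"
proof
  assume d: "nf (2 * i) (2 * j) False \<in> derived G (preim U)"
  obtain \<phi> where "group_hom G (wreath 4) \<phi>"
    and \<phi>: "\<And>i j. \<phi> (nf i j False) = (i mod 4, 3 * i mod 4, False)"
    and \<phi>r: "\<And>i j. snd (snd (\<phi> (nf i j True)))"
    using wreath_hom[of 4 1 0 2] by (auto simp: mult.commute)
  then interpret \<phi>: group_hom G "wreath 4" \<phi> by simp
  have "\<phi> x \<otimes>\<^bsub>wreath 4\<^esub> \<phi> y = \<phi> y \<otimes>\<^bsub>wreath 4\<^esub> \<phi> x" if "x \<in> S" "y \<in> S" for x y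
  proof -
    obtain c d e where 1: "\<phi> (nf a b True) = (c, d, e)" by (cases "\<phi> (nf a b True)")
    have "x = nf a b True \<or> x = nf 0 1 False" "y = nf a b True \<or> y = nf 0 1 False" using that S(1) by auto
    then show ?thesis using 1 \<phi>r[of a b] by (auto simp: \<phi>)
  qed
  then have "\<phi> (nf (2 * i) (2 * j) False) = \<one>\<^bsub>wreath 4\<^esub>"
    using S d by (intro \<phi>.hom_derived_generate_trivial[of S]) auto
  then show "even i" by (simp add: \<phi>) presburger
next
  assume "even i"
  then obtain k where k: "i = 2 * k" by auto
  have "nf (2 * 0) (- 2 * 1) False \<in> derived G (preim U)" "nf (2 * 2) (- 2 * 0) False \<in> derived G (preim U)"
    using H subgroup.one_closed[OF U] by (intro nf_derived[of a b]; simp)+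
  from nf_lattice[OF derived_subgroup[OF U] this, of "- j" k]
  show "nf (2 * i) (2 * j) False \<in> derived G (preim U)" by (simp add: k mult.commute)
qed

text \<open>Here \<open>s \<mapsto> 1\<close>, and the image of \<open>t\<close> has order 4 and is inverted by
  \<open>r\<close>. Thus \<open>t\<^sup>2\<close> survives, but it becomes central, so that the listed
  generators of \<open>H\<close> have commuting images.\<close>

lemma derived_iff_even_t:
  assumes U: "subgroup U parity_group" and S: "S \<subseteq> {nf a b True, nf 1 0 False, nf 0 2 False}" "generate G S = preim U"
    and H: "(odd a, odd b, True) \<in> U" "(True, False, False) \<in> U"
  shows "nf (2 * i) (2 * j) False \<in> derived G (preim U) \<longleftrightarrow> even j"
proof
  assume d: "nf (2 * i) (2 * j) False \<in> derived G (preim U)"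
  have "(2 :: int) ^ (n + 1) mod 4 = 0" by (simp add: pow_n)
  then obtain \<phi> where "group_hom G (wreath 4) \<phi>"
    and \<phi>: "\<And>i j. \<phi> (nf i j False) = (j mod 4, - j mod 4, False)"
    and \<phi>r: "\<And>i j. snd (snd (\<phi> (nf i j True)))"
    using wreath_hom[of 4 0 1 "2 ^ n"] by auto
  then interpret \<phi>: group_hom G "wreath 4" \<phi> by simp
  have "\<phi> x \<otimes>\<^bsub>wreath 4\<^esub> \<phi> y = \<phi> y \<otimes>\<^bsub>wreath 4\<^esub> \<phi> x" if "x \<in> S" "y \<in> S" for x y
  proof -
    obtain c d e where 1: "\<phi> (nf a b True) = (c, d, e)" by (cases "\<phi> (nf a b True)")
    have "x = nf a b True \<or> x = nf 1 0 False \<or> x = nf 0 2 False"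
         "y = nf a b True \<or> y = nf 1 0 False \<or> y = nf 0 2 False" using that S(1) by auto
    then show ?thesis using 1 \<phi>r[of a b] by (auto simp: \<phi> add.commute)
  qed
  then have "\<phi> (nf (2 * i) (2 * j) False) = \<one>\<^bsub>wreath 4\<^esub>"
    using S d by (intro \<phi>.hom_derived_generate_trivial[of S]) auto
  then show "even j" by (simp add: \<phi>) presburger
next
  assume "even j"
  then obtain k where k: "j = 2 * k" by auto
  have "nf (2 * 1) (- 2 * 0) False \<in> derived G (preim U)" "nf (2 * 0) (- 2 * 2) False \<in> derived G (preim U)"
    using H subgroup.one_closed[OF U] by (intro nf_derived[of a b]; simp)+
  from nf_lattice[OF derived_subgroup[OF U] this, of i "- k"]
  show "nf (2 * i) (2 * j) False \<in> derived G (preim U)" by (simp add: k mult.commute)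
qed

text \<open>Here \<open>s t \<mapsto> 1\<close>, and the common image of \<open>s\<close> and
  \<open>t\<^sup>-\<^sup>1\<close> has order 4 and is inverted by \<open>r\<close>. Only the parity of \<open>i
  + j\<close> can be seen, because \<open>s\<^sup>2\<close> and \<open>t\<^sup>2\<close> have the same image, a
  central involution.\<close>

lemma derived_iff_even_sum:
  assumes U: "subgroup U parity_group" and S: "S \<subseteq> {nf a b True, nf 1 1 False, nf 2 0 False}" "generate G S = preim U"
    and H: "(odd a, odd b, True) \<in> U" "(True, True, False) \<in> U"
  shows "nf (2 * i) (2 * j) False \<in> derived G (preim U) \<longleftrightarrow> even (i + j)"
proof
  assume d: "nf (2 * i) (2 * j) False \<in> derived G (preim U)"
  have "4 mod 4 = 2 ^ (n + 1) * (- 1) mod (4 :: int)" by (simp add: pow_n)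
  then obtain \<phi> where "group_hom G (wreath 4) \<phi>"
    and \<phi>: "\<And>i j. \<phi> (nf i j False) = ((i - j) mod 4, (i * 3 + j) mod 4, False)"
    and \<phi>r: "\<And>i j. snd (snd (\<phi> (nf i j True)))"
    using wreath_hom[of 4 1 "- 1" "2 - 2 ^ n"] by auto
  then interpret \<phi>: group_hom G "wreath 4" \<phi> by simp
  have "\<phi> x \<otimes>\<^bsub>wreath 4\<^esub> \<phi> y = \<phi> y \<otimes>\<^bsub>wreath 4\<^esub> \<phi> x" if "x \<in> S" "y \<in> S" for x y
  proof -
    obtain c d e where 1: "\<phi> (nf a b True) = (c, d, e)" by (cases "\<phi> (nf a b True)")
    have "x = nf a b True \<or> x = nf 1 1 False \<or> x = nf 2 0 False"
         "y = nf a b True \<or> y = nf 1 1 False \<or> y = nf 2 0 False" using that S(1) by auto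
    then show ?thesis using 1 \<phi>r[of a b] by (auto simp: \<phi> add.commute)
  qed
  then have "\<phi> (nf (2 * i) (2 * j) False) = \<one>\<^bsub>wreath 4\<^esub>"
    using S d by (intro \<phi>.hom_derived_generate_trivial[of S]) auto
  then show "even (i + j)" by (simp add: \<phi>) presburger
next
  assume "even (i + j)"
  then obtain k where "i + j = 2 * k" by (rule evenE)
  then have k: "i = 2 * k - j" by simp
  have "nf (2 * 1) (- 2 * 1) False \<in> derived G (preim U)" "nf (2 * 2) (- 2 * 0) False \<in> derived G (preim U)"
    using H subgroup.one_closed[OF U] by (intro nf_derived[of a b]; simp)+
  from nf_lattice[OF derived_subgroup[OF U] this, of "- j" k]
  show "nf (2 * i) (2 * j) False \<in> derived G (preim U)" by (simp add: k algebra_simps)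
qed


section \<open>The subgroups of index 2 and 4\<close>

lemma gens_simps:
  "nf 1 0 False = s" "nf 0 1 False = t" "nf 0 0 True = r" "nf 1 1 False = s \<otimes> t"
  "nf 1 0 True = s \<otimes> r" "nf 0 1 True = t \<otimes> r" "nf 1 1 True = s \<otimes> t \<otimes> r"
  "nf 2 0 False = s [^] (2::nat)" "nf 0 2 False = t [^] (2::nat)"
proof -
  have "s [^] (2::int) = s [^] (2::nat)" "t [^] (2::int) = t [^] (2::nat)"
    using int_pow_int[of G s 2] int_pow_int[of G t 2] by simp_all
  then show "nf 2 0 False = s [^] (2::nat)" "nf 0 2 False = t [^] (2::nat)" by (simp_all add: nf_def)
qed (simp_all add: nf_def)

lemmas fold_Gn = G[symmetric] s_def[symmetric] t_def[symmetric] r_def[symmetric]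

text \<open>A subgroup that contains \<open>s\<^sup>2\<close> and \<open>t\<^sup>2\<close> contains
  \<open>G\<^sub>n'\<close>, and is then determined by the parity vectors of its generators.\<close>

lemma generate_eq_preim_nf:
  assumes S: "S \<subseteq> carrier G" and sq: "nf 2 0 False \<in> generate G S" "nf 0 2 False \<in> generate G S"
    and U: "generate parity_group (par ` S) = U"
  shows "generate G S = preim U"
  unfolding U[symmetric]
proof (rule generate_eq_preim[OF S], rule subsetI)
  fix x assume x: "x \<in> preim {\<one>\<^bsub>parity_group\<^esub>}"
  then obtain i j c where "x = nf i j c" by (auto simp: preim_def elim: nf_exhaust)
  then have "x = nf i j False" "even i" "even j" using x by auto
  then have "x = nf (i div 2 * 2 + j div 2 * 0) (i div 2 * 0 + j div 2 * 2) False" by simp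
  then show "x \<in> generate G S"
    using nf_lattice[OF generate_is_subgroup[OF S] sq] by metis
qed

lemma nf_sq_mem:
  assumes "subgroup K G" "nf a b True \<in> K"
  shows "nf (4 * a + 2) (2 * m) False \<in> K"
  using subgroup.m_closed[OF assms(1,2,2)] by (simp add: nf_mult pow_n algebra_simps)

text \<open>The square of \<open>s\<^sup>a t\<^sup>b r\<close> is \<open>s\<^bsup>4a+2\<^esup> t\<^bsup>2m\<^esup>\<close>.
  Powers of \<open>t\<^sup>2\<close> remove the second factor, and raising to the power \<open>2a + 1\<close>
  turns the first into \<open>s\<^sup>2\<close> because \<open>(2a + 1)(4a + 2)\<close> is 2 modulo 8.\<close>

lemma s2_mem:
  assumes K: "subgroup K G" and a: "nf a b True \<in> K" and t: "nf 0 2 False \<in> K"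
  shows "nf 2 0 False \<in> K"
proof -
  have "nf ((2 * a + 1) * (4 * a + 2) + - ((2 * a + 1) * m) * 0) ((2 * a + 1) * (2 * m) + - ((2 * a + 1) * m) * 2) False \<in> K"
    by (rule nf_lattice[OF K nf_sq_mem[OF K a] t])
  moreover have "nf ((2 * a + 1) * (4 * a + 2) + - ((2 * a + 1) * m) * 0) ((2 * a + 1) * (2 * m) + - ((2 * a + 1) * m) * 2) False
    = nf (8 * (a * a + a) + 2) 0 False" by (simp add: algebra_simps)
  moreover have "nf (8 * (a * a + a) + 2) 0 False = nf 2 0 False"
    by (rule nf_cong) simp
  ultimately show ?thesis by simp
qed

lemma t2_mem:
  assumes K: "subgroup K G" and st: "nf 1 1 False \<in> K" and s2: "nf 2 0 False \<in> K"
  shows "nf 0 2 False \<in> K"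
  using nf_lattice[OF K st s2, of 2 "- 1"] by simp

lemma squares_mem_n_eq_1:
  assumes "n = 1" and K: "subgroup K G" and a: "nf 0 b True \<in> K" and s: "nf 1 0 False \<in> K"
  shows "nf 2 0 False \<in> K" "nf 0 2 False \<in> K"
proof -
  have "m = 1" unfolding m_def using assms(1) by simp
  then show "nf 2 0 False \<in> K" "nf 0 2 False \<in> K"
    using nf_lattice[OF K s s, of 1 1] nf_lattice[OF K nf_sq_mem[OF K a] s, of 1 "- 2"] by simp_all
qed

text \<open>The commutator of \<open>t\<^sup>b r\<close> and \<open>s t\<close> is \<open>s\<^sup>2
  t\<^sup>-\<^sup>2\<close>, which yields \<open>t\<^sup>4\<close> by division from \<open>(s
  t)\<^sup>2\<close>. As \<open>m\<close> is even, \<open>t\<^bsup>2m\<^esup>\<close> is a power of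
  \<open>t\<^sup>4\<close>, and so the square of \<open>t\<^sup>b r\<close> gives \<open>s\<^sup>2\<close>. For
  \<open>n = 1\<close> this step fails, and \<open>s\<^sup>2\<close> has to be listed among the generators.\<close>

lemma squares_mem_n_neq_1:
  assumes "n \<noteq> 1" and K: "subgroup K G" and a: "nf 0 b True \<in> K" and st: "nf 1 1 False \<in> K"
  shows "nf 2 0 False \<in> K" "nf 0 2 False \<in> K"
proof -
  obtain k where k: "m = 2 * k" using even_m assms(1) by auto
  have "nf 0 b True \<otimes> nf 1 1 False \<otimes> inv (nf 0 b True) \<otimes> inv (nf 1 1 False) \<in> K"
    using K a st by (intro subgroup.m_closed subgroup.m_inv_closed)
  then have c: "nf 2 (- 2) False \<in> K" by (simp add: commutator_nf)
  have "nf (2 * 1 + - 1 * 2) (2 * 1 + - 1 * - 2) False \<in> K" by (rule nf_lattice[OF K st c])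
  then have t4: "nf 0 4 False \<in> K" by simp
  have "nf (1 * (4 * 0 + 2) + - k * 0) (1 * (2 * m) + - k * 4) False \<in> K"
    by (rule nf_lattice[OF K nf_sq_mem[OF K a] t4])
  then show "nf 2 0 False \<in> K" by (simp add: k)
  then show "nf 0 2 False \<in> K" by (rule t2_mem[OF K st])
qed

lemmas span_simps = parity_generate_insert parity_generate_empty

lemma nf_double_mem:
  assumes "subgroup K G" "nf i j False \<in> K" shows "nf (2 * i) (2 * j) False \<in> K"
  using nf_lattice[OF assms(1,2,2), of 1 1] by simp

text \<open>Each subgroup of index 2 is identified as the preimage of a plane in the space of parity vectors, and those
  containing some \<open>s\<^sup>a t\<^sup>b r\<close> come with the criterion for membership in their derived
  subgroup.\<close>

lemma H2_1: "H2 n 1 = preim {(a, b, c). \<not> c}"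
proof -
  let ?S = "{nf 1 0 False, nf 0 1 False}"
  have "subgroup (generate G ?S) G" by (rule generate_is_subgroup) auto
  then have "generate G ?S = preim {(a, b, c). \<not> c}"
    using nf_double_mem[of "generate G ?S" 1 0] nf_double_mem[of "generate G ?S" 0 1]
    by (intro generate_eq_preim_nf) (auto simp: span_simps generate.incl)
  moreover have "H2 n 1 = generate G ?S" by (simp add: H2_def fold_Gn gens_simps)
  ultimately show ?thesis by simp
qed

lemma H2_2:
  "H2 n 2 = preim {(a, b, c). \<not> b}"
  "nf (2 * i) (2 * j) False \<in> derived G (preim {(a, b, c). \<not> b}) \<longleftrightarrow> even j"
proof -
  define S where "S = (if n = 1 then {nf 1 0 False, nf 0 0 True} else {nf 1 0 False, nf 0 2 False, nf 0 0 True})"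
  have sub: "subgroup (generate G S) G" by (rule generate_is_subgroup) (auto simp: S_def)
  have S: "generate G S = preim {(a, b, c). \<not> b}"
  proof (rule generate_eq_preim_nf)
    show "nf 2 0 False \<in> generate G S" "nf 0 2 False \<in> generate G S"
      using squares_mem_n_eq_1[OF _ sub, of 0] nf_double_mem[OF sub, of 1 0]
      by (cases "n = 1"; simp add: generate.incl S_def)+
    show "generate parity_group (par ` S) = {(a, b, c). \<not> b}"
      by (cases "n = 1") (auto simp: S_def span_simps)
  qed (simp add: S_def)
  moreover have "H2 n 2 = generate G S" by (simp add: H2_def S_def fold_Gn gens_simps)
  ultimately show "H2 n 2 = preim {(a, b, c). \<not> b}" by simp
  have "subgroup {(a, b, c). \<not> b} parity_group"
    by (rule parity.subgroupI) (auto simp: parity_inv)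
  then show "nf (2 * i) (2 * j) False \<in> derived G (preim {(a, b, c). \<not> b}) \<longleftrightarrow> even j"
    using S by (intro derived_iff_even_t[of _ S 0 0]) (auto simp: S_def split: if_splits)
qed

lemma H2_3:
  "H2 n 3 = preim {(a, b, c). \<not> a}"
  "nf (2 * i) (2 * j) False \<in> derived G (preim {(a, b, c). \<not> a}) \<longleftrightarrow> even i"
proof -
  let ?S = "{nf 0 0 True, nf 0 1 False}"
  have sub: "subgroup (generate G ?S) G" by (rule generate_is_subgroup) auto
  have t2: "nf 0 2 False \<in> generate G ?S" using nf_double_mem[OF sub, of 0 1] by (simp add: generate.incl)
  then have S: "generate G ?S = preim {(a, b, c). \<not> a}"
    using s2_mem[OF sub _ t2, of 0 0]
    by (intro generate_eq_preim_nf) (auto simp: span_simps generate.incl)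
  moreover have "H2 n 3 = generate G ?S" by (simp add: H2_def fold_Gn gens_simps)
  ultimately show "H2 n 3 = preim {(a, b, c). \<not> a}" by simp
  have "subgroup {(a, b, c). \<not> a} parity_group"
    by (rule parity.subgroupI) (auto simp: parity_inv)
  then show "nf (2 * i) (2 * j) False \<in> derived G (preim {(a, b, c). \<not> a}) \<longleftrightarrow> even i"
    using S by (intro derived_iff_even_s[of _ ?S 0 0]) auto
qed

lemma H2_4:
  "H2 n 4 = preim {(a, b, c). a = b}"
  "nf (2 * i) (2 * j) False \<in> derived G (preim {(a, b, c). a = b}) \<longleftrightarrow> even (i + j)"
proof -
  define S where "S = (if n = 1 then {nf 1 1 False, nf 0 0 True, nf 2 0 False} else {nf 1 1 False, nf 0 0 True})"
  have sub: "subgroup (generate G S) G" by (rule generate_is_subgroup) (auto simp: S_def)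
  have S: "generate G S = preim {(a, b, c). a = b}"
  proof (rule generate_eq_preim_nf)
    show "nf 2 0 False \<in> generate G S" "nf 0 2 False \<in> generate G S"
      using t2_mem[OF sub] squares_mem_n_neq_1[OF _ sub, of 0]
      by (cases "n = 1"; simp add: generate.incl S_def)+
    show "generate parity_group (par ` S) = {(a, b, c). a = b}"
      by (cases "n = 1") (auto simp: S_def span_simps)
  qed (simp add: S_def)
  moreover have "H2 n 4 = generate G S" by (simp add: H2_def S_def fold_Gn gens_simps)
  ultimately show "H2 n 4 = preim {(a, b, c). a = b}" by simp
  have "subgroup {(a, b, c). a = b} parity_group"
    by (rule parity.subgroupI) (auto simp: parity_inv)
  then show "nf (2 * i) (2 * j) False \<in> derived G (preim {(a, b, c). a = b}) \<longleftrightarrow> even (i + j)"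
    using S by (intro derived_iff_even_sum[of _ S 0 0]) (auto simp: S_def split: if_splits)
qed

lemma H2_5:
  "H2 n 5 = preim {(a, b, c). a = c}"
  "nf (2 * i) (2 * j) False \<in> derived G (preim {(a, b, c). a = c}) \<longleftrightarrow> even i"
proof -
  let ?S = "{nf 1 0 True, nf 0 1 False}"
  have sub: "subgroup (generate G ?S) G" by (rule generate_is_subgroup) auto
  have t2: "nf 0 2 False \<in> generate G ?S" using nf_double_mem[OF sub, of 0 1] by (simp add: generate.incl)
  then have S: "generate G ?S = preim {(a, b, c). a = c}"
    using s2_mem[OF sub _ t2, of 1 0]
    by (intro generate_eq_preim_nf) (auto simp: span_simps generate.incl)
  moreover have "H2 n 5 = generate G ?S" by (simp add: H2_def fold_Gn gens_simps)
  ultimately show "H2 n 5 = preim {(a, b, c). a = c}" by simp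
  have "subgroup {(a, b, c). a = c} parity_group"
    by (rule parity.subgroupI) (auto simp: parity_inv)
  then show "nf (2 * i) (2 * j) False \<in> derived G (preim {(a, b, c). a = c}) \<longleftrightarrow> even i"
    using S by (intro derived_iff_even_s[of _ ?S 1 0]) auto
qed

lemma H2_6:
  "H2 n 6 = preim {(a, b, c). b = c}"
  "nf (2 * i) (2 * j) False \<in> derived G (preim {(a, b, c). b = c}) \<longleftrightarrow> even j"
proof -
  define S where "S = (if n = 1 then {nf 0 1 True, nf 1 0 False} else {nf 0 1 True, nf 1 0 False, nf 0 2 False})"
  have sub: "subgroup (generate G S) G" by (rule generate_is_subgroup) (auto simp: S_def)
  have S: "generate G S = preim {(a, b, c). b = c}"
  proof (rule generate_eq_preim_nf)
    show "nf 2 0 False \<in> generate G S" "nf 0 2 False \<in> generate G S"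
      using squares_mem_n_eq_1[OF _ sub, of 1] nf_double_mem[OF sub, of 1 0]
      by (cases "n = 1"; simp add: generate.incl S_def)+
    show "generate parity_group (par ` S) = {(a, b, c). b = c}"
      by (cases "n = 1") (auto simp: S_def span_simps)
  qed (simp add: S_def)
  moreover have "H2 n 6 = generate G S" by (simp add: H2_def S_def fold_Gn gens_simps)
  ultimately show "H2 n 6 = preim {(a, b, c). b = c}" by simp
  have "subgroup {(a, b, c). b = c} parity_group"
    by (rule parity.subgroupI) (auto simp: parity_inv)
  then show "nf (2 * i) (2 * j) False \<in> derived G (preim {(a, b, c). b = c}) \<longleftrightarrow> even j"
    using S by (intro derived_iff_even_t[of _ S 0 1]) (auto simp: S_def split: if_splits)
qed

lemma H2_7:
  "H2 n 7 = preim {(a, b, c). c = (a \<noteq> b)}"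
  "nf (2 * i) (2 * j) False \<in> derived G (preim {(a, b, c). c = (a \<noteq> b)}) \<longleftrightarrow> even (i + j)"
proof -
  define S where "S = (if n = 1 then {nf 1 1 False, nf 0 1 True, nf 2 0 False} else {nf 1 1 False, nf 0 1 True})"
  have sub: "subgroup (generate G S) G" by (rule generate_is_subgroup) (auto simp: S_def)
  have S: "generate G S = preim {(a, b, c). c = (a \<noteq> b)}"
  proof (rule generate_eq_preim_nf)
    show "nf 2 0 False \<in> generate G S" "nf 0 2 False \<in> generate G S"
      using t2_mem[OF sub] squares_mem_n_neq_1[OF _ sub, of 1]
      by (cases "n = 1"; simp add: generate.incl S_def)+
    show "generate parity_group (par ` S) = {(a, b, c). c = (a \<noteq> b)}"
      by (cases "n = 1") (auto simp: S_def span_simps)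
  qed (simp add: S_def)
  moreover have "H2 n 7 = generate G S" by (simp add: H2_def S_def fold_Gn gens_simps)
  ultimately show "H2 n 7 = preim {(a, b, c). c = (a \<noteq> b)}" by simp
  have "subgroup {(a, b, c). c = (a \<noteq> b)} parity_group"
    by (rule parity.subgroupI) (auto simp: parity_inv)
  then show "nf (2 * i) (2 * j) False \<in> derived G (preim {(a, b, c). c = (a \<noteq> b)}) \<longleftrightarrow> even (i + j)"
    using S by (intro derived_iff_even_sum[of _ S 0 1]) (auto simp: S_def split: if_splits)
qed

lemma H4_eq:
  "H4 n 1 = preim {(False, False, False), (True, False, False)}"
  "H4 n 2 = preim {(False, False, False), (False, True, False)}"
  "H4 n 3 = preim {(False, False, False), (False, False, True)}"
  "H4 n 4 = preim {(False, False, False), (True, True, False)}"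
  "H4 n 5 = preim {(False, False, False), (True, False, True)}"
  "H4 n 6 = preim {(False, False, False), (False, True, True)}"
  "H4 n 7 = preim {(False, False, False), (True, True, True)}"
proof -
  have sub: "subgroup (generate G {nf i j c, nf k l d}) G" for i j c k l d
    by (rule generate_is_subgroup) auto
  have mixed: "generate G {nf i j True, nf 0 2 False} = preim {(False, False, False), (odd i, odd j, True)}" for i j
    using s2_mem[OF sub, of i j i j True 0 2 False]
    by (intro generate_eq_preim_nf) (auto simp: span_simps generate.incl)
  have a: "generate G {nf 1 0 False, nf 0 2 False} = preim {(False, False, False), (True, False, False)}"
    using nf_double_mem[OF sub, of 1 0 1 0 False 0 2 False]
    by (intro generate_eq_preim_nf) (auto simp: span_simps generate.incl)
  have b: "generate G {nf 0 1 False, nf 2 0 False} = preim {(False, False, False), (False, True, False)}"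
    using nf_double_mem[OF sub, of 0 1 0 1 False 2 0 False]
    by (intro generate_eq_preim_nf) (auto simp: span_simps generate.incl)
  have c: "generate G {nf 1 1 False, nf 2 0 False} = preim {(False, False, False), (True, True, False)}"
    using t2_mem[OF sub, of 1 1 False 2 0 False]
    by (intro generate_eq_preim_nf) (auto simp: span_simps generate.incl)
  show "H4 n 1 = preim {(False, False, False), (True, False, False)}"
    "H4 n 2 = preim {(False, False, False), (False, True, False)}"
    "H4 n 3 = preim {(False, False, False), (False, False, True)}"
    "H4 n 4 = preim {(False, False, False), (True, True, False)}"
    "H4 n 5 = preim {(False, False, False), (True, False, True)}"
    "H4 n 6 = preim {(False, False, False), (False, True, True)}"
    "H4 n 7 = preim {(False, False, False), (True, True, True)}"
    using a b c mixed[of 0 0] mixed[of 1 0] mixed[of 0 1] mixed[of 1 1]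
    by (simp_all add: H4_def fold_Gn gens_simps)
qed


section \<open>Transfer kernels\<close>

text \<open>The subset of \<open>G\<^sub>n / G\<^sub>n'\<close> given by a condition on parities: the common form of the
  transfer kernels and of the subgroups they are compared with.\<close>

definition par_cosets :: "(bit3 \<Rightarrow> bool) \<Rightarrow> gen gword set set set" where
  "par_cosets p = (\<lambda>g. derived G (carrier G) #> g) ` {g \<in> carrier G. p (par g)}"

lemma gen_ab_eq:
  assumes "S \<subseteq> carrier G" "generate parity_group (par ` S) = {e. p e}"
  shows "gen_ab n S = par_cosets p"
  using generate_Mod_derived[OF derived_G assms(1)]
  unfolding gen_ab_def fold_Gn par_cosets_def assms(2) by simp

text \<open>With \<open>y = s\<^sup>k t\<^sup>l\<close>, the value is \<open>s\<^bsup>2a\<^esup> t\<^bsup>2b\<^esup>\<close>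
  for \<open>g = s\<^sup>a t\<^sup>b\<close>, whether or not \<open>g \<in> H\<close>. For \<open>g = s\<^sup>a
  t\<^sup>b r\<close> it is \<open>g\<^sup>2 = s\<^bsup>4a+2\<^esup> t\<^bsup>2m\<^esup>\<close>, multiplied by
  the commutator \<open>s\<^bsup>6k\<^esup> t\<^bsup>2l\<^esup>\<close> of \<open>g\<close> and \<open>y\<close>
  if \<open>g \<in> H\<close>.\<close>

lemma transfer_kernel_index2_nf:
  assumes U: "subgroup U parity_group" and y: "(odd k, odd l, False) \<notin> U"
    and index: "\<And>e. e \<in> U \<or> xor3 (odd k, odd l, False) e \<in> U"
    and crit: "\<And>i j. nf (2 * i) (2 * j) False \<in> derived G (preim U) \<longleftrightarrow> \<kappa> i j"
    and A: "\<And>(a :: int) (b :: int). \<kappa> a b \<longleftrightarrow> p (odd a, odd b, False)"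
    and T_in: "\<And>(a :: int) (b :: int). (odd a, odd b, True) \<in> U \<Longrightarrow> \<kappa> (2 * a + 3 * k + 1) (l + m) \<longleftrightarrow> p (odd a, odd b, True)"
    and T_notin: "\<And>(a :: int) (b :: int). (odd a, odd b, True) \<notin> U \<Longrightarrow> \<kappa> (2 * a + 1) m \<longleftrightarrow> p (odd a, odd b, True)"
  shows "transfer_kernel G (preim U) = par_cosets p"
  unfolding par_cosets_def
proof (rule transfer_kernel_index2[OF derived_G U])
  show "nf k l False \<in> carrier G" "par (nf k l False) \<notin> U" using y by auto
  show "e \<in> U \<or> par (nf k l False) \<otimes>\<^bsub>parity_group\<^esub> e \<in> U" for e using index by simp
  fix g assume "g \<in> carrier G"
  then obtain a b c where g: "g = nf a b c" by (rule nf_exhaust)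
  have sq: "nf a b False \<otimes> nf a b False = nf (2 * a) (2 * b) False"
    by (simp add: nf_mult)
  show "g \<otimes> (inv (nf k l False) \<otimes> g \<otimes> nf k l False) \<in> derived G (preim U) \<longleftrightarrow> p (par g)"
    if "par g \<in> U"
  proof (cases c)
    case True
    have v: "g \<otimes> (inv (nf k l False) \<otimes> g \<otimes> nf k l False)
        = nf (2 * (2 * a + 3 * k + 1)) (2 * (l + m)) False"
      using True by (simp add: g nf_mult nf_inv pow_n algebra_simps)
    show ?thesis unfolding v crit using that True T_in by (simp add: g)
  next
    case False
    then show ?thesis by (simp add: g conj_nf sq crit A)
  qed
  show "g \<otimes> g \<in> derived G (preim U) \<longleftrightarrow> p (par g)" if "par g \<notin> U"
  proof (cases c)
    case True
    have v: "g \<otimes> g = nf (2 * (2 * a + 1)) (2 * m) False"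
      using True by (simp add: g nf_mult pow_n algebra_simps)
    show ?thesis unfolding v crit using that True T_notin by (simp add: g)
  next
    case False
    then show ?thesis by (simp add: g sq crit A)
  qed
qed

lemma derived_abelian:
  assumes "\<And>a b c. (a, b, c) \<in> U \<Longrightarrow> \<not> c" "(False, False, False) \<in> U"
  shows "derived G (preim U) = {\<one>}"
proof -
  interpret id: group_hom G G "\<lambda>x. x"
    by unfold_locales (auto simp: hom_def)
  have "x = \<one>" if "x \<in> derived G (preim U)" for x
  proof (rule id.hom_derived_trivial[OF _ _ that])
    show "preim U \<subseteq> carrier G" by (auto simp: preim_def)
    fix x y assume x: "x \<in> preim U" and y: "y \<in> preim U"
    then have "x \<in> carrier G" "y \<in> carrier G" by (auto simp: preim_def)
    then obtain i j c k l d where xy: "x = nf i j c" "y = nf k l d"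
      by (elim nf_exhaust) (rule that)
    then have "\<not> c" "\<not> d" using x y assms(1) by auto
    then show "x \<otimes> y = y \<otimes> x" using xy by (simp add: nf_mult add.commute)
  qed
  moreover have "\<one> \<in> derived G (preim U)"
    by (rule subgroup.one_closed) (auto intro!: derived_is_subgroup simp: preim_def)
  ultimately show ?thesis by blast
qed

text \<open>The relation \<open>s\<^sup>4 = t\<^bsup>2^(n+1)\<^esup>\<close> forces any quotient that detects
  \<open>s\<^sup>4\<close> to retain the full order of \<open>t\<close>, so this is the one place where the
  modulus depends on \<open>n\<close>: \<open>N = 8m = 2\<^bsup>n+2\<^esup>\<close>, where \<open>t\<close> has
  eigenvalues of order \<open>N\<close> and \<open>s\<close> has eigenvalues of order 8.\<close>

lemma s4_neq_one: "nf 4 0 False \<noteq> \<one>"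
proof
  assume s4: "nf 4 0 False = \<one>"
  have m: "m > 0" by (simp add: m_def)
  \<comment> \<open>The parameters are \<open>p = m\<close>, \<open>u = 1\<close> and \<open>x = 2\<^sup>n + 2m = 4m\<close>.\<close>
  have "\<exists>\<phi>. group_hom G (wreath (8 * m)) \<phi> \<and>
    (\<forall>i j. \<phi> (nf i j False) = ((i * m + j * 1) mod (8 * m), (i * (3 * m) - j * 1) mod (8 * m), False)) \<and>
    (\<forall>i j. snd (snd (\<phi> (nf i j True))))"
    by (rule wreath_hom[where x = "4 * m"]) (use m in \<open>simp_all add: pow_n\<close>)
  then obtain \<phi> where "group_hom G (wreath (8 * m)) \<phi>"
    and \<phi>: "\<phi> (nf 4 0 False) = ((4 * m + 0 * 1) mod (8 * m), (4 * (3 * m) - 0 * 1) mod (8 * m), False)"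
    by blast
  then interpret \<phi>: group_hom G "wreath (8 * m)" \<phi> by simp
  have "\<phi> (nf 4 0 False) = (0, 0, False)" unfolding s4 by simp
  then have "4 * m mod (8 * m) = 0" by (simp add: \<phi>)
  then show False using m by simp
qed

text \<open>The group \<open>H\<^sub>1\<^sub>,\<^sub>2 = \<langle>s, t\<rangle>\<close> is abelian, so the question is which
  values are 1. For \<open>g = s\<^sup>a t\<^sup>b\<close> the value is \<open>s\<^bsup>4a\<^esup>\<close>,
  because conjugation by \<open>r\<close> inverts \<open>t\<close>. For the other elements it is
  \<open>s\<^bsup>4a+2\<^esup> t\<^bsup>2m\<^esup>\<close>, which is not 1 since it lies outside
  \<open>H\<^sub>3\<^sub>,\<^sub>2'\<close>.\<close>

lemma transfer_kernel_H2_1: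
  "transfer_kernel G (preim {(a, b, c). \<not> c}) = par_cosets (\<lambda>(a, b, c). \<not> a \<and> \<not> c)"
  unfolding par_cosets_def
proof (rule transfer_kernel_index2[OF derived_G, where y = "nf 0 0 True"])
  have D: "derived G (preim {(a, b, c). \<not> c}) = {\<one>}"
    by (rule derived_abelian) auto
  fix g assume "g \<in> carrier G"
  then obtain a b c where g: "g = nf a b c" by (rule nf_exhaust)
  show "g \<otimes> (inv (nf 0 0 True) \<otimes> g \<otimes> nf 0 0 True) \<in> derived G (preim {(a, b, c). \<not> c})
      \<longleftrightarrow> (case par g of (a, b, c) \<Rightarrow> \<not> a \<and> \<not> c)"
    if "par g \<in> {(a, b, c). \<not> c}"
  proof -
    have c: "\<not> c" using that by (simp add: g)
    then have v: "g \<otimes> (inv (nf 0 0 True) \<otimes> g \<otimes> nf 0 0 True) = nf (4 * a) 0 False"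
      by (simp add: g conj_nf nf_mult)
    have "nf (4 * a) 0 False = (if even a then \<one> else nf 4 0 False)"
      unfolding nf_gens(4) by (auto intro!: nf_cong elim!: evenE oddE)
    then show ?thesis using c s4_neq_one unfolding v by (simp add: D g)
  qed
  show "g \<otimes> g \<in> derived G (preim {(a, b, c). \<not> c}) \<longleftrightarrow> (case par g of (a, b, c) \<Rightarrow> \<not> a \<and> \<not> c)"
    if "par g \<notin> {(a, b, c). \<not> c}"
  proof -
    have c: "c" using that by (simp add: g)
    then have v: "g \<otimes> g = nf (2 * (2 * a + 1)) (2 * m) False"
      by (simp add: g nf_mult pow_n algebra_simps)
    have "nf (2 * (2 * a + 1)) (2 * m) False \<notin> derived G (preim {(a, b, c). \<not> a})"
      unfolding H2_3(2) by simp
    moreover have "\<one> \<in> derived G (preim {(a, b, c). \<not> a})"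
      by (rule subgroup.one_closed) (auto intro!: derived_is_subgroup simp: preim_def)
    ultimately show ?thesis using c unfolding v by (auto simp: D g)
  qed
qed (auto intro!: parity.subgroupI simp: parity_inv)

lemma index4_subgroup: "subgroup {(False, False, False), e} parity_group"
  by (rule parity.subgroupI; cases e; auto simp: parity_inv)

text \<open>A formulation of unique existence that simplification decides once all bits are known.\<close>

lemma ex1_filter:
  assumes "length (filter P zs) = 1" shows "\<exists>!z. z \<in> set zs \<and> P z"
proof -
  obtain z where "filter P zs = [z]" using assms by (auto simp: length_Suc_conv)
  then have "{x \<in> set zs. P x} = {z}" by (metis set_filter list.set(1) list.simps(15))
  then show ?thesis by (intro ex1I[of _ z]) blast+
qed

text \<open>The following five facts say that explicit lists of parity vectors are transversals, in the space of parity
  vectors, of the span of a line \<open>U\<close> and the vector \<open>(u, v, w)\<close> of \<open>g\<close>.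
  They distinguish whether \<open>U\<close> lies in the plane \<open>c = 0\<close>, which corresponds to
  \<open>H \<subseteq> \<langle>s, t\<rangle>\<close>, and whether \<open>g \<in> H\<close>. The two bits
  \<open>k, l\<close> choose one of \<open>s\<close> and \<open>t\<close> outside the span.\<close>

lemma transversal_bits_mixed_in:
  assumes "(u, v, w) \<in> {(False, False, False), (x, y, True)}"
  shows "\<exists>!z. z \<in> set [(False, False, False), (True, False, False), (False, True, False), (True, True, False)] \<and>
    (xor3 z e \<in> {(False, False, False), (x, y, True)} \<or> xor3 (xor3 z e) (u, v, w) \<in> {(False, False, False), (x, y, True)})"
proof -
  obtain p q o' where "e = (p, q, o')" by (cases e)
  then show ?thesis
    using assms
    by (intro ex1_filter; cases p; cases q; cases o'; cases x; cases y; cases u; cases v; cases w; simp)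
qed

lemma transversal_bits_mixed_notin:
  assumes "(u, v, w) \<notin> {(False, False, False), (x, y, True)}" "k = ((u, v) \<noteq> (if w then (\<not> x, y) else (True, False)))" "l = (\<not> k)"
  shows "\<exists>!z. z \<in> set [(False, False, False), (k, l, False)] \<and>
    (xor3 z e \<in> {(False, False, False), (x, y, True)} \<or> xor3 (xor3 z e) (u, v, w) \<in> {(False, False, False), (x, y, True)})"
proof -
  obtain p q o' where "e = (p, q, o')" by (cases e)
  then show ?thesis
    using assms
    by (intro ex1_filter; cases p; cases q; cases o'; cases x; cases y; cases u; cases v; cases w; simp)
qed

lemma transversal_bits_abelian_in:
  assumes "(u, v, w) \<in> {(False, False, False), (x, y, False)}" "k = (\<not> x \<or> y)" "l = (\<not> k)" "x \<or> y"
  shows "\<exists>!z. z \<in> set [(False, False, False), (k, l, False), (False, False, True), (k, l, True)] \<and>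
    (xor3 z e \<in> {(False, False, False), (x, y, False)} \<or> xor3 (xor3 z e) (u, v, w) \<in> {(False, False, False), (x, y, False)})"
proof -
  obtain p q o' where "e = (p, q, o')" by (cases e)
  then show ?thesis
    using assms
    by (intro ex1_filter; cases p; cases q; cases o'; cases x; cases y; cases u; cases v; cases w; simp)
qed

lemma transversal_bits_abelian_notin_even:
  assumes "(u, v, w) \<notin> {(False, False, False), (x, y, False)}" "\<not> w" "x \<or> y"
  shows "\<exists>!z. z \<in> set [(False, False, False), (False, False, True)] \<and>
    (xor3 z e \<in> {(False, False, False), (x, y, False)} \<or> xor3 (xor3 z e) (u, v, w) \<in> {(False, False, False), (x, y, False)})"
proof -
  obtain p q o' where "e = (p, q, o')" by (cases e)
  then show ?thesis
    using assms
    by (intro ex1_filter; cases p; cases q; cases o'; cases x; cases y; cases u; cases v; cases w; simp)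
qed

lemma transversal_bits_abelian_notin_odd:
  assumes "(u, v, w) \<notin> {(False, False, False), (x, y, False)}" w "k = (\<not> x \<or> y)" "l = (\<not> k)" "x \<or> y"
  shows "\<exists>!z. z \<in> set [(False, False, False), (k, l, False)] \<and>
    (xor3 z e \<in> {(False, False, False), (x, y, False)} \<or> xor3 (xor3 z e) (u, v, w) \<in> {(False, False, False), (x, y, False)})"
proof -
  obtain p q o' where "e = (p, q, o')" by (cases e)
  then show ?thesis
    using assms
    by (intro ex1_filter; cases p; cases q; cases o'; cases x; cases y; cases u; cases v; cases w; simp)
qed

lemma carrier_Gn_ab: "carrier (Gn_ab n) = par_cosets (\<lambda>_. True)"
  by (auto simp: par_cosets_def FactGroup_def RCOSETS_def fold_Gn)

text \<open>The subgroup contains \<open>s\<^sup>2, t\<^sup>2\<close> and some \<open>s\<^sup>a t\<^sup>b r\<close>, so its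
  derived subgroup contains \<open>s\<^sup>4\<close> and \<open>t\<^sup>4\<close>. Representatives can be taken
  in \<open>\<langle>s, t\<rangle>\<close>, and all values turn out to have exponents divisible by 4.\<close>

lemma transfer_kernel_index4_mixed:
  "transfer_kernel G (preim {(False, False, False), (x, y, True)}) = carrier (Gn_ab n)"
  (is "transfer_kernel G (preim ?U) = _")
  unfolding carrier_Gn_ab par_cosets_def
proof (rule transfer_kernel_preim[OF derived_G index4_subgroup])
  have D: "nf i j False \<in> derived G (preim ?U)" if "4 dvd i" "4 dvd j" for i j
  proof -
    obtain k l where kl: "i = 4 * k" "j = 4 * l" using \<open>4 dvd i\<close> \<open>4 dvd j\<close> by (auto simp: dvd_def)
    have e: "(odd (of_bool x :: int), odd (of_bool y :: int), True) = (x, y, True)" by auto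
    have "nf (2 * 2) (- 2 * 0) False \<in> derived G (preim ?U)" "nf (2 * 0) (- 2 * 2) False \<in> derived G (preim ?U)"
      by (intro nf_derived[of "of_bool x" "of_bool y"]; simp add: e)+
    from nf_lattice[OF derived_subgroup[OF index4_subgroup] this, of k "- l"]
    show ?thesis by (simp add: kl mult.commute)
  qed
  fix g assume "g \<in> carrier G"
  then obtain a b c where g: "g = nf a b c" by (rule nf_exhaust)
  show "\<exists>ys. distinct (map par ys) \<and> set ys \<subseteq> carrier G \<and>
       (\<forall>e \<in> carrier parity_group. \<exists>!z. z \<in> set (map par ys) \<and>
          (z \<otimes>\<^bsub>parity_group\<^esub> e \<in> ?U \<or> z \<otimes>\<^bsub>parity_group\<^esub> e \<otimes>\<^bsub>parity_group\<^esub> par g \<in> ?U)) \<and>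
       (conj_prod (if par g \<in> ?U then g else g \<otimes> g) ys \<in> derived G (preim ?U) \<longleftrightarrow> True)"
  proof (cases "par g \<in> ?U")
    case True
    define ys where "ys = [nf 0 0 False, nf 1 0 False, nf 0 1 False, nf 1 1 False]"
    have zs: "map par ys = [(False, False, False), (True, False, False), (False, True, False), (True, True, False)]" by (simp add: ys_def)
    have "\<exists>!z. z \<in> set (map par ys) \<and> (xor3 z e \<in> ?U \<or> xor3 (xor3 z e) (par g) \<in> ?U)" for e
      unfolding zs g par_nf by (rule transversal_bits_mixed_in) (use True in \<open>simp_all add: g\<close>)
    moreover have "conj_prod g ys \<in> derived G (preim ?U)"
    proof (cases c)
      case True
      \<comment> \<open>Moving \<open>r\<close> past a power of \<open>s\<close> triples the exponent, so \<open>8a + 16\<close> shows up as \<open>40a + 80\<close>, which agrees with it modulo 8.\<close>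
      then have "conj_prod g ys = nf (40 * a + 80) (4 * m) False"
        by (simp add: ys_def g nf_mult nf_inv pow_n nf_gens(4) algebra_simps)
      then show ?thesis using D[of "40 * a + 80" "4 * m"] by simp
    next
      case False
      then have "conj_prod g ys = nf (4 * a) (4 * b) False"
        by (simp add: ys_def g conj_nf nf_mult nf_gens(4)) 
      then show ?thesis using D[of "4 * a" "4 * b"] by simp
    qed
    ultimately show ?thesis using True by (intro exI[of _ ys]) (auto simp: ys_def)
  next
    case False
    define k l :: int where "k = of_bool ((odd a, odd b) \<noteq> (if c then (\<not> x, y) else (True, False)))"
      and "l = 1 - k"
    then have y: "odd k = ((odd a, odd b) \<noteq> (if c then (\<not> x, y) else (True, False)))" "odd l = (\<not> odd k)"
      by simp_all
    define ys where "ys = [nf 0 0 False, nf k l False]"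
    have zs: "map par ys = [(False, False, False), (odd k, odd l, False)]" by (simp add: ys_def)
    have "\<exists>!z. z \<in> set (map par ys) \<and> (xor3 z e \<in> ?U \<or> xor3 (xor3 z e) (par g) \<in> ?U)" for e
      unfolding zs g par_nf by (rule transversal_bits_mixed_notin) (use False y(1) in \<open>auto simp: g y(2)\<close>)
    moreover have "conj_prod (g \<otimes> g) ys \<in> derived G (preim ?U)"
    proof (cases c)
      case True
      then have "g \<otimes> g = nf (4 * a + 2) (2 * m) False"
        by (simp add: g nf_mult pow_n) 
      then have "conj_prod (g \<otimes> g) ys = nf (8 * a + 4) (4 * m) False"
        by (simp add: ys_def conj_nf nf_mult nf_gens(4))
      then show ?thesis using D[of "8 * a + 4" "4 * m"] by simp
    next
      case False
      then have "g \<otimes> g = nf (2 * a) (2 * b) False"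
        by (simp add: g nf_mult) 
      then have "conj_prod (g \<otimes> g) ys = nf (4 * a) (4 * b) False"
        by (simp add: ys_def conj_nf nf_mult nf_gens(4)) 
      then show ?thesis using D[of "4 * a" "4 * b"] by simp
    qed
    ultimately show ?thesis using False y by (intro exI[of _ ys]) (auto simp: ys_def)
  qed
qed

text \<open>The subgroup is contained in \<open>\<langle>s, t\<rangle>\<close>, so the value itself must be 1. For \<open>g
  = s\<^sup>a t\<^sup>b\<close> half of the representatives involve \<open>r\<close> and cancel the powers of
  \<open>t\<close>, leaving \<open>s\<^bsup>8a\<^esup>\<close>. For \<open>g = s\<^sup>a t\<^sup>b r\<close> the
  square is fixed by the representatives chosen in \<open>\<langle>s, t\<rangle>\<close>, so the value is
  \<open>g\<^sup>4 = s\<^bsup>8a+4\<^esup> t\<^bsup>4m\<^esup>\<close>, which is 1 because \<open>s\<^sup>4 =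
  t\<^bsup>4m\<^esup>\<close>.\<close>

lemma transfer_kernel_index4_abelian:
  assumes xy: "x \<or> y"
  shows "transfer_kernel G (preim {(False, False, False), (x, y, False)}) = carrier (Gn_ab n)"
  (is "transfer_kernel G (preim ?U) = _")
  unfolding carrier_Gn_ab par_cosets_def
proof (rule transfer_kernel_preim[OF derived_G index4_subgroup])
  have D: "derived G (preim ?U) = {\<one>}" by (rule derived_abelian) auto
  fix g assume "g \<in> carrier G"
  then obtain a b c where g: "g = nf a b c" by (rule nf_exhaust)
  define k l :: int where "k = of_bool (\<not> x \<or> y)" and "l = 1 - k"
  then have kl: "odd k = (\<not> x \<or> y)" "odd l = (\<not> odd k)" by simp_all
  show "\<exists>ys. distinct (map par ys) \<and> set ys \<subseteq> carrier G \<and>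
       (\<forall>e \<in> carrier parity_group. \<exists>!z. z \<in> set (map par ys) \<and>
          (z \<otimes>\<^bsub>parity_group\<^esub> e \<in> ?U \<or> z \<otimes>\<^bsub>parity_group\<^esub> e \<otimes>\<^bsub>parity_group\<^esub> par g \<in> ?U)) \<and>
       (conj_prod (if par g \<in> ?U then g else g \<otimes> g) ys \<in> derived G (preim ?U) \<longleftrightarrow> True)"
  proof -
    consider (U) "par g \<in> ?U" | (A) "par g \<notin> ?U" "\<not> c" | (T) "par g \<notin> ?U" c by blast
    then show ?thesis
    proof cases
      case U
      then have c: "\<not> c" by (auto simp: g)
      define ys where "ys = [nf 0 0 False, nf k l False, nf 0 0 True, nf k l True]"
      have zs: "map par ys = [(False, False, False), (odd k, odd l, False), (False, False, True), (odd k, odd l, True)]" by (simp add: ys_def)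
      have "\<exists>!z. z \<in> set (map par ys) \<and> (xor3 z e \<in> ?U \<or> xor3 (xor3 z e) (par g) \<in> ?U)" for e
        unfolding zs g par_nf by (rule transversal_bits_abelian_in) (use U kl xy in \<open>simp_all add: g\<close>)
      moreover have "conj_prod g ys = nf (8 * a) 0 False"
        using c by (simp add: ys_def g conj_nf nf_mult nf_gens(4))
      ultimately show ?thesis using U kl nf_cong[of "8 * a" 0 0 False]
        by (intro exI[of _ ys]) (auto simp: ys_def D nf_gens(4))
    next
      case A
      define ys where "ys = [nf 0 0 False, nf 0 0 True]"
      have zs: "map par ys = [(False, False, False), (False, False, True)]" by (simp add: ys_def)
      have "\<exists>!z. z \<in> set (map par ys) \<and> (xor3 z e \<in> ?U \<or> xor3 (xor3 z e) (par g) \<in> ?U)" for e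
        unfolding zs g par_nf by (rule transversal_bits_abelian_notin_even) (use A xy in \<open>simp_all add: g\<close>)
      moreover have "conj_prod (g \<otimes> g) ys = nf (8 * a) 0 False"
      proof -
        have "g \<otimes> g = nf (2 * a) (2 * b) False" using A(2) by (simp add: g nf_mult)
        then show ?thesis by (simp add: ys_def conj_nf nf_mult nf_gens(4))
      qed
      ultimately show ?thesis using A nf_cong[of "8 * a" 0 0 False]
        by (intro exI[of _ ys]) (auto simp: ys_def D nf_gens(4))
    next
      case T
      define ys where "ys = [nf 0 0 False, nf k l False]"
      have zs: "map par ys = [(False, False, False), (odd k, odd l, False)]" by (simp add: ys_def)
      have "\<exists>!z. z \<in> set (map par ys) \<and> (xor3 z e \<in> ?U \<or> xor3 (xor3 z e) (par g) \<in> ?U)" for e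
        unfolding zs g par_nf by (rule transversal_bits_abelian_notin_odd) (use T kl xy in \<open>simp_all add: g\<close>)
      moreover have "conj_prod (g \<otimes> g) ys = \<one>"
      proof -
        have "g \<otimes> g = nf (4 * a + 2) (2 * m) False" using T(2) by (simp add: g nf_mult pow_n)
        then have "conj_prod (g \<otimes> g) ys = nf (8 * a + 4) (4 * m) False"
          by (simp add: ys_def conj_nf nf_mult nf_gens(4))
        also have "\<dots> = nf (- 4) (4 * m) False" by (rule nf_cong) simp
        also have "\<dots> = inv (nf 4 (- (2 ^ (n + 1))) False)" by (simp add: nf_inv pow_n)
        also have "\<dots> = \<one>" by (simp only: nf_s4 inv_one)
        finally show ?thesis .
      qed
      ultimately show ?thesis using T kl
        by (intro exI[of _ ys]) (auto simp: ys_def D)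
    qed
  qed
qed

lemma transfer_kernel_H4: "i \<in> {1..7} \<Longrightarrow> transfer_kernel G (H4 n i) = carrier (Gn_ab n)"
proof -
  assume "i \<in> {1..7}"
  then consider "i = 1" | "i = 2" | "i = 3" | "i = 4" | "i = 5" | "i = 6" | "i = 7"
    by (auto simp: numeral_eq_Suc le_Suc_eq)
  then show ?thesis by cases (simp_all only: H4_eq transfer_kernel_index4_mixed transfer_kernel_index4_abelian simp_thms)
qed

lemma transfer_kernel_H2:
  "transfer_kernel G (H2 n 1) = par_cosets (\<lambda>(a, b, c). \<not> a \<and> \<not> c)"
  "transfer_kernel G (H2 n 2) = par_cosets (\<lambda>(a, b, c). if n = 1 then \<not> b else b = c)"
  "transfer_kernel G (H2 n 3) = par_cosets (\<lambda>(a, b, c). \<not> a)"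
  "transfer_kernel G (H2 n 4) = par_cosets (\<lambda>(a, b, c). if n = 1 then c = (a \<noteq> b) else a = b)"
  "transfer_kernel G (H2 n 5) = par_cosets (\<lambda>(a, b, c). a = c)"
  "transfer_kernel G (H2 n 6) = par_cosets (\<lambda>(a, b, c). if n = 1 then b = c else \<not> b)"
  "transfer_kernel G (H2 n 7) = par_cosets (\<lambda>(a, b, c). if n = 1 then a = b else c = (a \<noteq> b))"
proof -
  have U: "subgroup {(a, b, c). \<not> b} parity_group" "subgroup {(a, b, c). \<not> a} parity_group"
    "subgroup {(a, b, c). a = b} parity_group" "subgroup {(a, b, c). a = c} parity_group"
    "subgroup {(a, b, c). b = c} parity_group" "subgroup {(a, b, c). c = (a \<noteq> b)} parity_group"
    by (auto intro!: parity.subgroupI simp: parity_inv)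
  show "transfer_kernel G (H2 n 1) = par_cosets (\<lambda>(a, b, c). \<not> a \<and> \<not> c)"
    unfolding H2_1 by (rule transfer_kernel_H2_1)
  show "transfer_kernel G (H2 n 2) = par_cosets (\<lambda>(a, b, c). if n = 1 then \<not> b else b = c)"
    unfolding H2_2(1) by (rule transfer_kernel_index2_nf[OF U(1) _ _ H2_2(2), of 0 1]) (auto simp: even_m)
  show "transfer_kernel G (H2 n 3) = par_cosets (\<lambda>(a, b, c). \<not> a)"
    unfolding H2_3(1) by (rule transfer_kernel_index2_nf[OF U(2) _ _ H2_3(2), of 1 0]) (auto simp: even_m)
  show "transfer_kernel G (H2 n 4) = par_cosets (\<lambda>(a, b, c). if n = 1 then c = (a \<noteq> b) else a = b)"
    unfolding H2_4(1) by (rule transfer_kernel_index2_nf[OF U(3) _ _ H2_4(2), of 1 0]) (auto simp: even_m)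
  show "transfer_kernel G (H2 n 5) = par_cosets (\<lambda>(a, b, c). a = c)"
    unfolding H2_5(1) by (rule transfer_kernel_index2_nf[OF U(4) _ _ H2_5(2), of 1 0]) (auto simp: even_m)
  show "transfer_kernel G (H2 n 6) = par_cosets (\<lambda>(a, b, c). if n = 1 then b = c else \<not> b)"
    unfolding H2_6(1) by (rule transfer_kernel_index2_nf[OF U(5) _ _ H2_6(2), of 0 1]) (auto simp: even_m)
  show "transfer_kernel G (H2 n 7) = par_cosets (\<lambda>(a, b, c). if n = 1 then a = b else c = (a \<noteq> b))"
    unfolding H2_7(1) by (rule transfer_kernel_index2_nf[OF U(6) _ _ H2_7(2), of 1 0]) (auto simp: even_m)
qed

lemma gen_ab_cosets:
  "gen_ab n {t} = par_cosets (\<lambda>(a, b, c). \<not> a \<and> \<not> c)"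
  "gen_ab n {s, r} = par_cosets (\<lambda>(a, b, c). \<not> b)"
  "gen_ab n {r, s} = par_cosets (\<lambda>(a, b, c). \<not> b)"
  "gen_ab n {s, t \<otimes> r} = par_cosets (\<lambda>(a, b, c). b = c)"
  "gen_ab n {t, r} = par_cosets (\<lambda>(a, b, c). \<not> a)"
  "gen_ab n {t \<otimes> r, s \<otimes> r} = par_cosets (\<lambda>(a, b, c). c = (a \<noteq> b))"
  "gen_ab n {s \<otimes> t, r} = par_cosets (\<lambda>(a, b, c). a = b)"
  "gen_ab n {t, s \<otimes> r} = par_cosets (\<lambda>(a, b, c). a = c)"
  "gen_ab n {s \<otimes> t, t \<otimes> r} = par_cosets (\<lambda>(a, b, c). c = (a \<noteq> b))"
  by (rule gen_ab_eq; auto simp: span_simps par)+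

end

theorem theorem7:
  fixes n :: nat
  assumes "n \<ge> 1"
  shows
    "transfer_kernel (Gn n) (H2 n 1) = gen_ab n {\<tau> n} \<and>
     transfer_kernel (Gn n) (H2 n 2) =
       (if n = 1 then gen_ab n {\<sigma> n, \<rho> n} else gen_ab n {\<sigma> n, \<tau> n \<otimes>\<^bsub>Gn n\<^esub> \<rho> n}) \<and>
     transfer_kernel (Gn n) (H2 n 3) = gen_ab n {\<tau> n, \<rho> n} \<and>
     transfer_kernel (Gn n) (H2 n 4) =
       (if n = 1 then gen_ab n {\<tau> n \<otimes>\<^bsub>Gn n\<^esub> \<rho> n, \<sigma> n \<otimes>\<^bsub>Gn n\<^esub> \<rho> n}
        else gen_ab n {\<sigma> n \<otimes>\<^bsub>Gn n\<^esub> \<tau> n, \<rho> n}) \<and>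
     transfer_kernel (Gn n) (H2 n 5) = gen_ab n {\<tau> n, \<sigma> n \<otimes>\<^bsub>Gn n\<^esub> \<rho> n} \<and>
     transfer_kernel (Gn n) (H2 n 6) =
       (if n = 1 then gen_ab n {\<sigma> n, \<tau> n \<otimes>\<^bsub>Gn n\<^esub> \<rho> n} else gen_ab n {\<rho> n, \<sigma> n}) \<and>
     transfer_kernel (Gn n) (H2 n 7) =
       (if n = 1 then gen_ab n {\<sigma> n \<otimes>\<^bsub>Gn n\<^esub> \<tau> n, \<rho> n}
        else gen_ab n {\<sigma> n \<otimes>\<^bsub>Gn n\<^esub> \<tau> n, \<tau> n \<otimes>\<^bsub>Gn n\<^esub> \<rho> n}) \<and>
     (\<forall>i\<in>{1..7}. transfer_kernel (Gn n) (H4 n i) = carrier (Gn_ab n))"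
proof -
  interpret G_n n "Gn n" "\<sigma> n" "\<tau> n" "\<rho> n"
    using assms by unfold_locales auto
  show ?thesis
    unfolding transfer_kernel_H2 gen_ab_cosets using transfer_kernel_H4 by auto
qed

end
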